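(* Let $k\ge2$, $m\ge3$, $3\le g\le m$ and $0<\alpha<1$. Among all $k$-uniform linear unicyclic hypergraphs with $m$ hyperedges and girth $g$, the last hypergraph in $S_\alpha$-order is $C_g^{(k)}\odot S_{m-g}^{(k)}$.
   Context: Hypergraphs are finite; $k$-uniform means every hyperedge has exactly $k$ vertices; linear means any two distinct hyperedges share at most one vertex; unicyclic means connected with exactly one cycle; the girth is the minimum length of a cycle. A cored vertex is a vertex of degree one. A pendant hyperedge is a hyperedge containing $k-1$ cored vertices; "adding a pendant hyperedge to a vertex $v$" means adding a new hyperedge consisting of $v$ and $k-1$ new vertices. The hypercycle $C_g^{(k)}$ is obtained from the cycle graph $C_g$ by inserting $k-2$ new (cored) vertices into each edge. $C_g^{(k)}\odot S_{m-g}^{(k)}$ is obtained from $C_g^{(k)}$ by adding $m-g$ pendant hyperedges to one non-cored vertex of $C_g^{(k)}$. For a $k$-uniform hypergraph $\mathcal{H}$ on $[n]$, $\mathcal{A}(\mathcal{H})$ is the $k$-order $n$-dimensional tensor with entry $\frac1{(k-1)!}$ at $(i_1,\dots,i_k)$ if $\{i_1,\dots,i_k\}\in E(\mathcal{H})$ and $0$ otherwise; $\mathcal{D}(\mathcal{H})$ is the diagonal tensor of vertex degrees; $\mathcal{A}_\alpha(\mathcal{H})=\alpha\mathcal{D}(\mathcal{H})+(1-\alpha)\mathcal{A}(\mathcal{H})$. For a tensor $\mathcal{T}$, $\mathrm{Tr}_d(\mathcal{T})$ is the sum of the $d$-th powers of all $n(k-1)^{n-1}$ eigenvalues of $\mathcal{T}$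 (roots of its characteristic polynomial, with multiplicity); in particular $\mathrm{Tr}_0(\mathcal{T})=n(k-1)^{n-1}$, and for $d\ge1$ $$\mathrm{Tr}_{d}(\mathcal{T})=(k-1)^{n-1}\sum_{d_1+\cdots+d_n=d}\ \prod_{i=1}^{n}\frac{1}{(d_i(k-1))!}\Big(\sum_{\gamma\in[n]^{k-1}}(\mathcal{T})_{i\gamma}\frac{\partial}{\partial a_{i\gamma}}\Big)^{d_i}\mathrm{tr}\big(A^{d(k-1)}\big),$$ with $A=(a_{ij})$ an $n\times n$ matrix of indeterminates, $d_i\ge0$ integers, $\frac{\partial}{\partial a_{i\gamma}}=\frac{\partial}{\partial a_{i i_2}}\cdots\frac{\partial}{\partial a_{i i_k}}$ for $\gamma=i_2\cdots i_k$. $S_\alpha$-order: for $k$-uniform hypergraphs $\mathcal{H}_1,\mathcal{H}_2$ with $n$ vertices, $\mathcal{H}_1\prec_\alpha\mathcal{H}_2$ if there is $d\in\{1,\dots,n(k-1)^{n-1}-1\}$ with $\mathrm{Tr}_t(\mathcal{A}_\alpha(\mathcal{H}_1))=\mathrm{Tr}_t(\mathcal{A}_\alpha(\mathcal{H}_2))$ for $t=0,\dots,d-1$ and $\mathrm{Tr}_d(\mathcal{A}_\alpha(\mathcal{H}_1))<\mathrm{Tr}_d(\mathcal{A}_\alpha(\mathcal{H}_2))$. "$X$ is the last hypergraph in a class" means $X$ is in the class and $\mathcal{H}\prec_\alpha X$ for every $\mathcal{H}$ in the class not isomorphic to $X$. *)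

theory Defs
  imports "HOL-Library.Poly_Mapping" "Jordan_Normal_Form.Matrix" Complex_Main
begin

section \<open>Hypergraphs\<close>

record 'a hypergraph =
  verts :: "'a set"
  hedges :: "'a set set"

definition hypergraph :: "'a hypergraph \<Rightarrow> bool" where
  "hypergraph H \<longleftrightarrow> finite (verts H) \<and> (\<forall>e \<in> hedges H. e \<noteq> {} \<and> e \<subseteq> verts H)"

definition uniform :: "nat \<Rightarrow> 'a hypergraph \<Rightarrow> bool" where
  "uniform k H \<longleftrightarrow> (\<forall>e \<in> hedges H. card e = k)"

definition linear_hypergraph :: "'a hypergraph \<Rightarrow> bool" where
  "linear_hypergraph H \<longleftrightarrow>
     (\<forall>e \<in> hedges H. \<forall>f \<in> hedges H. e \<noteq> f \<longrightarrow> card (e \<inter> f) \<le> 1)"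

definition vdegree :: "'a hypergraph \<Rightarrow> 'a \<Rightarrow> nat" where
  "vdegree H v = card {e \<in> hedges H. v \<in> e}"

definition connected_hypergraph :: "'a hypergraph \<Rightarrow> bool" where
  "connected_hypergraph H \<longleftrightarrow> verts H \<noteq> {} \<and>
     (\<forall>u \<in> verts H. \<forall>v \<in> verts H. (u, v) \<in> {(x, y). \<exists>e \<in> hedges H. x \<in> e \<and> y \<in> e}\<^sup>*)"

text \<open>
  A (Berge) cycle \<open>v\<^sub>0 e\<^sub>0 v\<^sub>1 e\<^sub>1 \<dots> v\<^sub>0\<close>, of length at least 2, with distinct vertices and
  distinct hyperedges. In a linear hypergraph its length is automatically at least 3.
\<close>
definition is_cycle :: "'a hypergraph \<Rightarrow> 'a list \<Rightarrow> 'a set list \<Rightarrow> bool" where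
  "is_cycle H vs es \<longleftrightarrow>
     length es = length vs \<and> 2 \<le> length vs \<and> distinct vs \<and> distinct es \<and>
     set es \<subseteq> hedges H \<and>
     (\<forall>i < length vs. vs ! i \<in> es ! i \<and> vs ! (Suc i mod length vs) \<in> es ! i)"

text \<open>
  The vertex-hyperedge incidences traversed by a cyclic sequence. Two sequences describe the
  same cycle (they differ by a rotation and possibly a reversal) iff they traverse the same
  incidences, so cycles are counted as such sets.
\<close>
definition cycle_incidences :: "'a list \<Rightarrow> 'a set list \<Rightarrow> ('a \<times> 'a set) set" where
  "cycle_incidences vs es =
     (\<Union>i < length vs. {(vs ! i, es ! i), (vs ! (Suc i mod length vs), es ! i)})"

definition unicyclic :: "'a hypergraph \<Rightarrow> bool" where
  "unicyclic H \<longleftrightarrow> connected_hypergraph H \<and>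
     (\<exists>!C. \<exists>vs es. is_cycle H vs es \<and> C = cycle_incidences vs es)"

definition girth :: "'a hypergraph \<Rightarrow> nat" where
  "girth H = (LEAST q. \<exists>vs es. is_cycle H vs es \<and> length es = q)"

definition isomorphic :: "'a hypergraph \<Rightarrow> 'b hypergraph \<Rightarrow> bool" where
  "isomorphic H1 H2 \<longleftrightarrow>
     (\<exists>f. bij_betw f (verts H1) (verts H2) \<and> (\<lambda>e. f ` e) ` hedges H1 = hedges H2)"

text \<open>
  Hypergraphs carrying tensors have vertex set \<open>{..<n}\<close> (playing the role of \<open>[n]\<close>); every finite
  hypergraph is isomorphic to one of these.
\<close>
definition unicyclic_class :: "nat \<Rightarrow> nat \<Rightarrow> nat \<Rightarrow> nat hypergraph set" where
  "unicyclic_class k m g = {H. hypergraph H \<and> (\<exists>n. verts H = {..<n}) \<and> uniform k H \<and>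
     linear_hypergraph H \<and> unicyclic H \<and> card (hedges H) = m \<and> girth H = g}"

text \<open>
  The vertices of the cycle graph are the numbers \<open>j * (k - 1)\<close> for \<open>j < g\<close>; its \<open>j\<close>-th edge, joining
  \<open>j * (k - 1)\<close> to the cyclically next vertex, receives the \<open>k - 2\<close> numbers following \<open>j * (k - 1)\<close>
  as new vertices.
\<close>
definition hypercycle :: "nat \<Rightarrow> nat \<Rightarrow> nat hypergraph" where
  "hypercycle k g =
     \<lparr> verts = {..<g * (k - 1)},
       hedges = (\<lambda>j. insert ((Suc j mod g) * (k - 1)) {j * (k - 1)..<Suc j * (k - 1)}) ` {..<g} \<rparr>"

text \<open>For \<open>H\<close> on \<open>{..<n}\<close>, the \<open>k - 1\<close> new vertices are \<open>n, \<dots>, n + k - 2\<close>.\<close>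
definition add_pendant :: "nat \<Rightarrow> nat \<Rightarrow> nat hypergraph \<Rightarrow> nat hypergraph" where
  "add_pendant k v H = (let new = {card (verts H)..<card (verts H) + (k - 1)} in
     \<lparr> verts = verts H \<union> new, hedges = insert (insert v new) (hedges H) \<rparr>)"

text \<open>
  The hypercycle with \<open>s\<close> pendant hyperedges added at the non-cored vertex \<open>0\<close>; by rotational symmetry
  every other non-cored vertex gives an isomorphic hypergraph.
\<close>
definition hypercycle_star :: "nat \<Rightarrow> nat \<Rightarrow> nat \<Rightarrow> nat hypergraph" where
  "hypercycle_star k g s = (add_pendant k 0 ^^ s) (hypercycle k g)"


section \<open>Tensors and their traces\<close>

text \<open>
  A real tensor of order \<open>k\<close> and dimension \<open>n\<close> is given by its entries at the multi-indices, which are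
  lists of length \<open>k\<close> over \<open>{..<n}\<close>; values at other lists are irrelevant.
\<close>
type_synonym tensor = "nat list \<Rightarrow> real"

definition adjacency_tensor :: "nat \<Rightarrow> nat hypergraph \<Rightarrow> tensor" where
  "adjacency_tensor k H is = (if set is \<in> hedges H then 1 / fact (k - 1) else 0)"

definition degree_tensor :: "nat hypergraph \<Rightarrow> tensor" where
  "degree_tensor H is = (if \<forall>j \<in> set is. j = hd is then real (vdegree H (hd is)) else 0)"

definition A_alpha :: "real \<Rightarrow> nat \<Rightarrow> nat hypergraph \<Rightarrow> tensor" where
  "A_alpha \<alpha> k H is = \<alpha> * degree_tensor H is + (1 - \<alpha>) * adjacency_tensor k H is"

text \<open>
  Real polynomials in the indeterminates \<open>a\<^sub>i\<^sub>j\<close>, indexed by pairs: finitely supported maps from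
  monomials (exponent vectors) to coefficients.
\<close>
type_synonym mpoly = "(nat \<times> nat \<Rightarrow>\<^sub>0 nat) \<Rightarrow>\<^sub>0 real"

definition Const :: "real \<Rightarrow> mpoly" where
  "Const c = Poly_Mapping.single 0 c"

definition Var :: "nat \<times> nat \<Rightarrow> mpoly" where
  "Var x = Poly_Mapping.single (Poly_Mapping.single x 1) 1"

definition partial :: "nat \<times> nat \<Rightarrow> mpoly \<Rightarrow> mpoly" where
  "partial x p = (\<Sum>u \<in> Poly_Mapping.keys p.
     Poly_Mapping.single (u - Poly_Mapping.single x 1)
       (of_nat (Poly_Mapping.lookup u x) * Poly_Mapping.lookup p u))"

text \<open>\<open>\<partial>/\<partial>a\<^sub>i\<^sub>\<gamma>\<close> is the composition of the \<open>\<partial>/\<partial>a\<^sub>i\<^sub>j\<close> for \<open>j\<close> in \<open>\<gamma>\<close>.\<close>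
definition partial_multi :: "nat \<Rightarrow> nat list \<Rightarrow> mpoly \<Rightarrow> mpoly" where
  "partial_multi i \<gamma> p = fold (\<lambda>j. partial (i, j)) \<gamma> p"

definition row_operator :: "nat \<Rightarrow> nat \<Rightarrow> tensor \<Rightarrow> nat \<Rightarrow> mpoly \<Rightarrow> mpoly" where
  "row_operator n k T i p =
     (\<Sum>\<gamma> | length \<gamma> = k - 1 \<and> set \<gamma> \<subseteq> {..<n}. Const (T (i # \<gamma>)) * partial_multi i \<gamma> p)"

definition trace_power :: "nat \<Rightarrow> nat \<Rightarrow> mpoly" where
  "trace_power n r = (\<Sum>i < n. (mat n n Var ^\<^sub>m r) $$ (i, i))"

text \<open>
  The summand belonging to \<open>(d\<^sub>1, \<dots>, d\<^sub>n)\<close> in the trace formula. The operators for different rows commute,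
  so their product is composed in an arbitrary order.
\<close>
definition trace_summand :: "nat \<Rightarrow> nat \<Rightarrow> tensor \<Rightarrow> nat \<Rightarrow> nat list \<Rightarrow> mpoly" where
  "trace_summand n k T d ds =
     fold (\<lambda>i p. Const (1 / fact (ds ! i * (k - 1))) * (row_operator n k T i ^^ (ds ! i)) p)
       [0..<n] (trace_power n (d * (k - 1)))"

text \<open>
  The trace \<open>Tr\<^sub>d\<close> of a tensor of order \<open>k\<close> and dimension \<open>n\<close>, i.e. the sum of the \<open>d\<close>-th powers of its
  \<open>n * (k - 1) ^ (n - 1)\<close> eigenvalues, by the differential operator formula of Morozov and Shakirov.
  Each summand is a constant polynomial, since \<open>d * (k - 1)\<close> derivatives are applied to a
  homogeneous polynomial of that degree; the constant coefficient is its value.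
\<close>
definition Tr :: "nat \<Rightarrow> nat \<Rightarrow> nat \<Rightarrow> tensor \<Rightarrow> real" where
  "Tr n k d T =
     (if d = 0 then real (n * (k - 1) ^ (n - 1))
      else real ((k - 1) ^ (n - 1)) *
        (\<Sum>ds | length ds = n \<and> sum_list ds = d.
           Poly_Mapping.lookup (trace_summand n k T d ds) 0))"

definition S_less :: "real \<Rightarrow> nat \<Rightarrow> nat hypergraph \<Rightarrow> nat hypergraph \<Rightarrow> bool" where
  "S_less \<alpha> k H1 H2 \<longleftrightarrow> card (verts H1) = card (verts H2) \<and>
     (let n = card (verts H1) in
      \<exists>d \<in> {1..n * (k - 1) ^ (n - 1) - 1}.
        (\<forall>t < d. Tr n k t (A_alpha \<alpha> k H1) = Tr n k t (A_alpha \<alpha> k H2)) \<and>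
        Tr n k d (A_alpha \<alpha> k H1) < Tr n k d (A_alpha \<alpha> k H2))"

definition is_last :: "real \<Rightarrow> nat \<Rightarrow> nat hypergraph set \<Rightarrow> nat hypergraph \<Rightarrow> bool" where
  "is_last \<alpha> k \<C> X \<longleftrightarrow> X \<in> \<C> \<and> (\<forall>H \<in> \<C>. \<not> isomorphic H X \<longrightarrow> S_less \<alpha> k H X)"

end

theory Submission
  imports Defs
begin

text \<open>
  The vertices of a unicyclic \<open>k\<close>-uniform hypergraph with \<open>m\<close> hyperedges number \<open>m (k - 1)\<close>: the
  bipartite incidence graph is a spanning tree plus one incidence. Hence \<open>Tr\<^sub>0\<close> and \<open>Tr\<^sub>1\<close>, which
  only depend on the number of vertices and on the degree sum, are constant on the class. In
  \<open>Tr\<^sub>2\<close>, a monomial contributes only if its arcs form a closed walk; therefore \<open>Tr\<^sub>2\<close> is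
  \<open>(k - 1)^(n - 1) \<alpha>\<^sup>2 \<Sum>\<^sub>v d(v)\<^sup>2\<close> up to a constant, which is nonzero for \<open>k = 2\<close> only. So the order
  is already decided at \<open>d = 2\<close> by the sum of the squared degrees. Given that the degrees exceed
  \<open>1\<close> by \<open>m\<close> in total and that the \<open>g\<close> vertices of the cycle have degree at least \<open>2\<close>, this sum is
  maximal iff all the remaining excess \<open>m - g\<close> sits at one cycle vertex. Every hyperedge outside the
  cycle meets a vertex of degree at least \<open>2\<close>, hence this vertex, and the hypergraph is
  the hypercycle with \<open>m - g\<close> pendant hyperedges at it.
\<close>

section \<open>Coefficients of traces of matrix powers\<close>

text \<open>The trace formula is never expanded. A monomial is read as a multiset of arcs, and a
  coefficient of a derivative at \<open>u\<close> is a multiple of the coefficient of the original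
  polynomial at \<open>u\<close> plus the differentiated arcs. So the constant coefficient of each
  summand is a sum of tensor entries times weights times single coefficients of the trace of a
  matrix power. With at most two rows involved, all arcs start in one of two vertices, whereas a
  nonzero off-diagonal entry reaches all k vertices of a hyperedge; for k \<ge> 3 some vertex is
  then entered and never left.

  Uniqueness of the cycle is turned into a count through a spanning tree: each incidence off the
  tree closes a cycle containing it, so two of them would give two cycles. Strictness needs more
  than the bound on the squares: a hypergraph attaining it has to be shown isomorphic to the
  extremal one. This is done by cutting both into blocks of k - 1 vertices, one per hyperedge, as in
  the numbering produced by \<open>hypercycle\<close> and \<open>add_pendant\<close>.\<close>

definition arc :: "nat \<times> nat \<Rightarrow> (nat \<times> nat \<Rightarrow>\<^sub>0 nat)" where
  "arc x = Poly_Mapping.single x 1"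

lemma lookup_arc: "Poly_Mapping.lookup (arc x) y = (if x = y then 1 else 0)"
  by (simp add: arc_def lookup_single when_def)

lemma Var_arc: "Var x = Poly_Mapping.single (arc x) 1"
  by (simp add: Var_def arc_def)

lemma lookup_Const_times: "Poly_Mapping.lookup (Const c * p) u = c * Poly_Mapping.lookup p u"
proof -
  have "Const c * p = Poly_Mapping.map ((*) c) p"
    by (simp add: Const_def mult_map_scale_conv_mult)
  then show ?thesis by (simp add: Poly_Mapping.map.rep_eq when_def)
qed

lemma lookup_Var: "Poly_Mapping.lookup (Var x) u = of_bool (u = arc x)"
  by (auto simp: Var_arc lookup_single)

lemma arc_diff_add:
  assumes "Poly_Mapping.lookup u x \<noteq> 0"
  shows "(u - arc x) + arc x = u"
  using assms by (intro poly_mapping_eqI) (auto simp: lookup_add lookup_minus lookup_arc)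

text \<open>Exponents are subtracted with truncation, hence the guard: if \<open>x\<close> does not
  occur in \<open>u\<close>, then \<open>u - arc x\<close> is \<open>u\<close> itself, although no
  multiple of \<open>Var x\<close> contains the monomial \<open>u\<close>.\<close>

lemma lookup_times_Var:
  "Poly_Mapping.lookup (p * Var x) u =
     (if Poly_Mapping.lookup u x = 0 then 0 else Poly_Mapping.lookup p (u - arc x))"
proof -
  have "Poly_Mapping.lookup (Var x * p) u = (\<Sum>q. Poly_Mapping.lookup p q when u = arc x + q)"
    by (simp add: lookup_mult Var_arc lookup_single when_mult Sum_any_when_independent)
  also have "\<dots> = (if Poly_Mapping.lookup u x = 0 then 0 else Poly_Mapping.lookup p (u - arc x))"
  proof (cases "Poly_Mapping.lookup u x = 0")
    case True
    then have "u \<noteq> arc x + q" for q by (auto simp: lookup_add lookup_arc)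
    with True show ?thesis by simp
  next
    case False
    have "u = arc x + q \<longleftrightarrow> q = u - arc x" for q
      using arc_diff_add[OF False] by (metis add.commute add_diff_cancel_left')
    with False show ?thesis by simp
  qed
  finally show ?thesis by (simp add: mult.commute)
qed

text \<open>Seen from the resulting monomial \<open>u\<close>, only the single monomial
  \<open>u + arc x\<close> contributes, and truncated subtraction disappears from the
  formula.\<close>

lemma lookup_partial:
  "Poly_Mapping.lookup (partial x p) u =
     real (Poly_Mapping.lookup u x + 1) * Poly_Mapping.lookup p (u + arc x)"
proof -
  have "Poly_Mapping.lookup (partial x p) u =
    (\<Sum>v \<in> Poly_Mapping.keys p. (real (Poly_Mapping.lookup v x) * Poly_Mapping.lookup p v when v - arc x = u))"
    by (simp add: partial_def arc_def lookup_sum lookup_single)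
  also have "\<dots> = (\<Sum>v \<in> Poly_Mapping.keys p. if v = u + arc x then real (Poly_Mapping.lookup u x + 1) * Poly_Mapping.lookup p (u + arc x) else 0)"
  proof (rule sum.cong[OF refl])
    fix v
    show "(real (Poly_Mapping.lookup v x) * Poly_Mapping.lookup p v when v - arc x = u) =
      (if v = u + arc x then real (Poly_Mapping.lookup u x + 1) * Poly_Mapping.lookup p (u + arc x) else 0)"
    proof (cases "v = u + arc x")
      case True
      then show ?thesis by (simp add: lookup_add lookup_arc)
    next
      case False
      \<comment> \<open>If \<open>x\<close> does not occur in \<open>v\<close>, truncation can still
        give \<open>v - arc x = u\<close>; such a term is killed by its factor
        \<open>lookup v x\<close>.\<close>
      then have "Poly_Mapping.lookup v x = 0 \<or> v - arc x \<noteq> u"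
        using arc_diff_add[of v x] by auto
      with False show ?thesis by auto
    qed
  qed
  also have "\<dots> = real (Poly_Mapping.lookup u x + 1) * Poly_Mapping.lookup p (u + arc x)"
    by (simp add: in_keys_iff)
  finally show ?thesis .
qed

definition arcs :: "(nat \<times> nat) list \<Rightarrow> (nat \<times> nat \<Rightarrow>\<^sub>0 nat)" where
  "arcs xs = sum_list (map arc xs)"

lemma arcs_simps [simp]: "arcs [] = 0" "arcs (x # xs) = arc x + arcs xs"
  "arcs (xs @ ys) = arcs xs + arcs ys"
  by (simp_all add: arcs_def)

text \<open>The product of the exponents that come down while \<open>u + arcs xs\<close> is
  differentiated to \<open>u\<close>. Since \<open>fold\<close> applies the head first, the arcs of
  the tail are still present when the exponent of the head is taken.\<close>

fun derivative_weight :: "(nat \<times> nat \<Rightarrow>\<^sub>0 nat) \<Rightarrow> (nat \<times> nat) list \<Rightarrow> real" where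
  "derivative_weight u [] = 1"
| "derivative_weight u (x # xs) = derivative_weight u xs * real (Poly_Mapping.lookup (u + arcs xs) x + 1)"

lemma lookup_fold_partial:
  "Poly_Mapping.lookup (fold partial xs p) u = derivative_weight u xs * Poly_Mapping.lookup p (u + arcs xs)"
  by (induction xs arbitrary: p) (simp_all add: lookup_partial add_ac)

lemma partial_multi_eq: "partial_multi i \<gamma> p = fold partial (map (Pair i) \<gamma>) p"
  by (simp add: partial_multi_def fold_map comp_def)

lemma lookup_arcs: "Poly_Mapping.lookup (arcs xs) x = count_list xs x"
  by (induction xs) (auto simp: lookup_add lookup_arc)

lemma derivative_weight_append: "derivative_weight u (xs @ ys) = derivative_weight u ys * derivative_weight (u + arcs ys) xs"
  by (induction xs) (simp_all add: add_ac)

lemma count_list_replicate: "count_list (replicate r x) y = (if x = y then r else 0)"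
  by (induction r) auto

lemma derivative_weight_replicate: "derivative_weight 0 (replicate r x) = fact r"
  by (induction r) (auto simp: lookup_arcs count_list_replicate mult_ac)

section \<open>Closed walks as a criterion for vanishing coefficients\<close>

inductive walk :: "nat \<Rightarrow> nat \<Rightarrow> (nat \<times> nat \<Rightarrow>\<^sub>0 nat) \<Rightarrow> bool" for a where
  walk_Nil: "walk a a 0"
| walk_snoc: "walk a l u \<Longrightarrow> walk a b (u + arc (l, b))"

lemma pow_mat_Var_Suc:
  assumes "a < n" "b < n"
  shows "(mat n n Var ^\<^sub>m Suc r) $$ (a, b) = (\<Sum>l<n. (mat n n Var ^\<^sub>m r) $$ (a, l) * Var (l, b))"
  using assms by (simp add: scalar_prod_def lessThan_atLeast0)

text \<open>The coefficient counts the walks whose multiset of arcs is \<open>u\<close>. For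
  vanishing results existence suffices, so \<open>walk\<close> records neither the length nor the
  bound \<open>n\<close>.\<close>

lemma pow_mat_Var_walk:
  assumes "a < n" "b < n" "Poly_Mapping.lookup ((mat n n Var ^\<^sub>m r) $$ (a, b)) u \<noteq> 0"
  shows "walk a b u"
  using assms(2,3)
proof (induction r arbitrary: b u)
  case 0
  then have "a = b" "u = 0"
    using assms(1) by (auto simp: lookup_one split: if_splits)
  then show ?case by (simp add: walk_Nil)
next
  case (Suc r)
  from Suc.prems(2) obtain l where l: "l < n"
    "Poly_Mapping.lookup ((mat n n Var ^\<^sub>m r) $$ (a, l) * Var (l, b)) u \<noteq> 0"
    unfolding pow_mat_Var_Suc[OF assms(1) Suc.prems(1)] lookup_sum
    by (meson lessThan_iff sum.not_neutral_contains_not_neutral)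
  then have u: "Poly_Mapping.lookup u (l, b) \<noteq> 0"
    and "Poly_Mapping.lookup ((mat n n Var ^\<^sub>m r) $$ (a, l)) (u - arc (l, b)) \<noteq> 0"
    by (auto simp: lookup_times_Var split: if_splits)
  then have "walk a l (u - arc (l, b))"
    using Suc.IH l(1) by blast
  from walk_snoc[OF this, of b] show ?case
    using arc_diff_add[OF u] by simp
qed

lemma walk_start: "walk a b u \<Longrightarrow> u = 0 \<and> a = b \<or> (\<exists>y. Poly_Mapping.lookup u (a, y) \<noteq> 0)"
proof (induction rule: walk.induct)
  case (walk_snoc l u b)
  from walk_snoc.IH show ?case
  proof
    assume "u = 0 \<and> a = l"
    then have "Poly_Mapping.lookup (u + arc (l, b)) (a, b) \<noteq> 0"
      by (simp add: lookup_add lookup_arc)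
    then show ?thesis by blast
  qed (auto simp: lookup_add)
qed simp

lemma walk_stop: "walk a b u \<Longrightarrow> u = 0 \<and> a = b \<or> (\<exists>x. Poly_Mapping.lookup u (x, b) \<noteq> 0)"
proof (induction rule: walk.induct)
  case (walk_snoc l u b)
  have "Poly_Mapping.lookup (u + arc (l, b)) (l, b) \<noteq> 0"
    by (simp add: lookup_add lookup_arc)
  then show ?case by blast
qed simp

text \<open>An arc into \<open>h\<close> that is not the last one is followed by an arc out of
  \<open>h\<close>. This balance of existence, without counting in- and out-degrees, is what the
  dead-end argument below needs.\<close>

lemma walk_head:
  "walk a b u \<Longrightarrow> Poly_Mapping.lookup u (x, h) \<noteq> 0 \<Longrightarrow> h = b \<or> (\<exists>y. Poly_Mapping.lookup u (h, y) \<noteq> 0)"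
proof (induction arbitrary: x h rule: walk.induct)
  case (walk_snoc l u b)
  show ?case
  proof (cases "Poly_Mapping.lookup u (x, h) = 0")
    case True
    then show ?thesis
      using walk_snoc.prems by (auto simp: lookup_add lookup_arc split: if_splits)
  next
    case False
    from walk_snoc.IH[OF this] show ?thesis
    proof
      assume "h = l"
      then have "Poly_Mapping.lookup (u + arc (l, b)) (h, b) \<noteq> 0"
        by (simp add: lookup_add lookup_arc)
      then show ?thesis by blast
    qed (auto simp: lookup_add)
  qed
qed simp

lemma walk_tail:
  "walk a b u \<Longrightarrow> Poly_Mapping.lookup u (h, y) \<noteq> 0 \<Longrightarrow> h = a \<or> (\<exists>x. Poly_Mapping.lookup u (x, h) \<noteq> 0)"
proof (induction arbitrary: h y rule: walk.induct)
  case (walk_snoc l u b)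
  show ?case
  proof (cases "Poly_Mapping.lookup u (h, y) = 0")
    case True
    then have "h = l"
      using walk_snoc.prems by (simp add: lookup_add lookup_arc split: if_splits)
    then show ?thesis using walk_stop[OF walk_snoc.hyps] by (auto simp: lookup_add)
  next
    case False
    from walk_snoc.IH[OF this] show ?thesis by (auto simp: lookup_add)
  qed
qed simp

lemma walk_loops:
  assumes "walk a b u" "\<And>x y. Poly_Mapping.lookup u (x, y) \<noteq> 0 \<Longrightarrow> x = y"
  shows "b = a \<and> (\<forall>x y. Poly_Mapping.lookup u (x, y) \<noteq> 0 \<longrightarrow> x = a)"
  using assms
proof (induction rule: walk.induct)
  case (walk_snoc l u b)
  have "b = l" using walk_snoc.prems[of l b] by (simp add: lookup_add lookup_arc)
  moreover have "l = a \<and> (\<forall>x y. Poly_Mapping.lookup u (x, y) \<noteq> 0 \<longrightarrow> x = a)"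
    by (rule walk_snoc.IH, rule walk_snoc.prems) (simp add: lookup_add)
  ultimately show ?case by (auto simp: lookup_add lookup_arc)
qed simp

lemma trace_power_walk:
  assumes "Poly_Mapping.lookup (trace_power n r) u \<noteq> 0"
  obtains a where "walk a a u"
proof -
  from assms obtain a where "a < n" "Poly_Mapping.lookup ((mat n n Var ^\<^sub>m r) $$ (a, a)) u \<noteq> 0"
    unfolding trace_power_def lookup_sum
    by (meson lessThan_iff sum.not_neutral_contains_not_neutral)
  then show thesis using pow_mat_Var_walk that by blast
qed

text \<open>The end of a closed walk is no exception to \<open>walk_head\<close>: it is also the
  start, and as \<open>u\<close> is not 0, \<open>walk_start\<close> supplies an arc leaving
  it.\<close>

lemma trace_power_dead_end:
  assumes "Poly_Mapping.lookup u (x, h) \<noteq> 0" "\<And>y. Poly_Mapping.lookup u (h, y) = 0"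
  shows "Poly_Mapping.lookup (trace_power n r) u = 0"
proof (rule ccontr)
  assume "Poly_Mapping.lookup (trace_power n r) u \<noteq> 0"
  then obtain a where a: "walk a a u" by (rule trace_power_walk)
  then have "h = a" using walk_head[OF a assms(1)] assms(2) by auto
  with walk_start[OF a] assms show False by auto
qed

text \<open>The mirror image is needed for a loop \<open>(j, j)\<close> together with an arc
  \<open>(i, j)\<close>: every head is also a tail there, but \<open>i\<close> is left and never
  entered.\<close>

lemma trace_power_dead_start:
  assumes "Poly_Mapping.lookup u (h, y) \<noteq> 0" "\<And>x. Poly_Mapping.lookup u (x, h) = 0"
  shows "Poly_Mapping.lookup (trace_power n r) u = 0"
proof (rule ccontr)
  assume "Poly_Mapping.lookup (trace_power n r) u \<noteq> 0"
  then obtain a where a: "walk a a u" by (rule trace_power_walk)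
  then have "h = a" using walk_tail[OF a assms(1)] assms(2) by auto
  with walk_stop[OF a] assms show False by auto
qed

lemma trace_power_two_loops:
  assumes "\<And>x y. Poly_Mapping.lookup u (x, y) \<noteq> 0 \<Longrightarrow> x = y"
    "Poly_Mapping.lookup u (i, i) \<noteq> 0" "Poly_Mapping.lookup u (j, j) \<noteq> 0" "i \<noteq> j"
  shows "Poly_Mapping.lookup (trace_power n r) u = 0"
proof (rule ccontr)
  assume "Poly_Mapping.lookup (trace_power n r) u \<noteq> 0"
  then obtain a where a: "walk a a u" by (rule trace_power_walk)
  from walk_loops[OF a assms(1)] assms(2-4) show False by blast
qed

text \<open>The only walk with these arcs stays at \<open>i\<close>. The end \<open>b\<close> is
  general because the recursion for matrix powers sums over the last vertex but one.\<close>

lemma pow_mat_Var_loop: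
  assumes "i < n" "b < n"
  shows "Poly_Mapping.lookup ((mat n n Var ^\<^sub>m r) $$ (i, b)) (arcs (replicate r (i, i))) = of_bool (b = i)"
  using assms(2)
proof (induction r arbitrary: b)
  case 0
  then show ?case using assms(1) by auto
next
  case (Suc r)
  have "Poly_Mapping.lookup ((mat n n Var ^\<^sub>m Suc r) $$ (i, b)) (arcs (replicate (Suc r) (i, i))) =
    (\<Sum>l<n. if l = i then of_bool (b = i) else 0)"
    unfolding pow_mat_Var_Suc[OF assms(1) Suc.prems] lookup_sum
  proof (rule sum.cong[OF refl])
    fix l assume "l \<in> {..<n}"
    then show "Poly_Mapping.lookup ((mat n n Var ^\<^sub>m r) $$ (i, l) * Var (l, b)) (arcs (replicate (Suc r) (i, i))) =
      (if l = i then of_bool (b = i) else 0)"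
      using Suc.IH[OF assms(1)]
      by (auto simp: lookup_times_Var lookup_add lookup_arc lookup_arcs count_list_replicate)
  qed
  then show ?case using assms(1) by simp
qed

lemma trace_power_loop:
  assumes "i < n" "0 < r"
  shows "Poly_Mapping.lookup (trace_power n r) (arcs (replicate r (i, i))) = 1"
proof -
  have *: "Poly_Mapping.lookup ((mat n n Var ^\<^sub>m r) $$ (a, a)) (arcs (replicate r (i, i))) = of_bool (a = i)"
    if "a < n" for a
  proof (cases "a = i")
    case True
    then show ?thesis using pow_mat_Var_loop[OF assms(1,1)] by simp
  next
    case False
    have "\<not> walk a a (arcs (replicate r (i, i)))"
    proof
      assume "walk a a (arcs (replicate r (i, i)))"
      from walk_start[OF this] show False
      proof
        assume "arcs (replicate r (i, i)) = 0 \<and> a = a"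
        then have "Poly_Mapping.lookup (arcs (replicate r (i, i))) (i, i) = 0" by simp
        with assms(2) show False by (simp add: lookup_arcs count_list_replicate)
      next
        assume "\<exists>y. Poly_Mapping.lookup (arcs (replicate r (i, i))) (a, y) \<noteq> 0"
        with False show False by (simp add: lookup_arcs count_list_replicate)
      qed
    qed
    then show ?thesis using pow_mat_Var_walk[OF that that, of r] False by auto
  qed
  show ?thesis
    unfolding trace_power_def lookup_sum using assms(1) by (simp add: * of_bool_def)
qed

text \<open>The two closed walks counted start at \<open>i\<close> and at \<open>j\<close>.\<close>

lemma trace_power_2_edge:
  assumes "i < n" "j < n" "i \<noteq> j"
  shows "Poly_Mapping.lookup (trace_power n 2) (arc (j, i) + arc (i, j)) = 2"
proof -
  have "Poly_Mapping.lookup (trace_power n 2) (arc (j, i) + arc (i, j)) =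
    (\<Sum>a<n. \<Sum>l<n. (if l = j then if a = i then 1 else 0 else 0) + (if l = i then if a = j then 1 else 0 else 0))"
    unfolding trace_power_def lookup_sum
  proof (rule sum.cong[OF refl])
    fix a assume a: "a \<in> {..<n}"
    have *: "(mat n n Var ^\<^sub>m 2) $$ (a, a) = (\<Sum>l<n. Var (a, l) * Var (l, a))"
      using a by (simp add: numeral_2_eq_2 scalar_prod_def lessThan_atLeast0)
    show "Poly_Mapping.lookup ((mat n n Var ^\<^sub>m 2) $$ (a, a)) (arc (j, i) + arc (i, j)) =
      (\<Sum>l<n. (if l = j then if a = i then 1 else 0 else 0) + (if l = i then if a = j then 1 else 0 else 0))"
      unfolding * lookup_sum
      by (rule sum.cong[OF refl])
        (use assms in \<open>auto simp: lookup_times_Var lookup_add lookup_arc lookup_Var\<close>)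
  qed
  also have "\<dots> = 2"
    using assms by (simp add: sum.distrib)
  finally show ?thesis .
qed

section \<open>The first two traces\<close>

abbreviation row_indices :: "nat \<Rightarrow> nat \<Rightarrow> nat list set" where
  "row_indices n k \<equiv> {\<gamma>. length \<gamma> = k - 1 \<and> set \<gamma> \<subseteq> {..<n}}"

lemma finite_row_indices: "finite (row_indices n k)"
  using finite_lists_length_eq[of "{..<n}" "k - 1"] by (simp add: conj_commute)

lemma lookup_row_operator:
  "Poly_Mapping.lookup (row_operator n k T i p) u =
    (\<Sum>\<gamma>\<in>row_indices n k. T (i # \<gamma>) * (derivative_weight u (map (Pair i) \<gamma>) *
       Poly_Mapping.lookup p (u + arcs (map (Pair i) \<gamma>))))"
  by (simp add: row_operator_def lookup_sum lookup_Const_times partial_multi_eq lookup_fold_partial)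

text \<open>When a single row acts, every multi-index other than the constant one will name a vertex
  that no arc leaves. This is the resulting collapse of the sum to the diagonal entry.\<close>

lemma lookup_row_operator_single:
  assumes "i < n"
    and "\<And>\<gamma>. \<gamma> \<in> row_indices n k \<Longrightarrow> \<gamma> \<noteq> replicate (k - 1) i \<Longrightarrow>
      T (i # \<gamma>) * Poly_Mapping.lookup p (u + arcs (map (Pair i) \<gamma>)) = 0"
  shows "Poly_Mapping.lookup (row_operator n k T i p) u =
    T (i # replicate (k - 1) i) * (derivative_weight u (replicate (k - 1) (i, i)) *
       Poly_Mapping.lookup p (u + arcs (replicate (k - 1) (i, i))))"
proof -
  have "Poly_Mapping.lookup (row_operator n k T i p) u = (\<Sum>\<gamma>\<in>row_indices n k.
    if \<gamma> = replicate (k - 1) i then T (i # replicate (k - 1) i) * (derivative_weight u (replicate (k - 1) (i, i)) *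
       Poly_Mapping.lookup p (u + arcs (replicate (k - 1) (i, i)))) else 0)"
    unfolding lookup_row_operator using assms(2) by (intro sum.cong) (auto simp: map_replicate)
  also have "\<dots> = T (i # replicate (k - 1) i) * (derivative_weight u (replicate (k - 1) (i, i)) *
       Poly_Mapping.lookup p (u + arcs (replicate (k - 1) (i, i))))"
    using assms(1) by (subst sum.delta[OF finite_row_indices]) (auto simp: set_replicate_conv_if)
  finally show ?thesis .
qed

lemma lookup_arcs_row:
  "Poly_Mapping.lookup (arcs (map (Pair i) \<gamma>)) (x, y) = (if x = i then count_list \<gamma> y else 0)"
  by (induction \<gamma>) (auto simp: lookup_add lookup_arc)

lemma not_replicate_ex: "length \<gamma> = r \<Longrightarrow> \<gamma> \<noteq> replicate r i \<Longrightarrow> \<exists>h\<in>set \<gamma>. h \<noteq> i"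
  by (metis replicate_eqI)

text \<open>All arcs start in \<open>i\<close> or \<open>j\<close>, so \<open>h\<close> is entered
  by an arc from \<open>i\<close> and never left. The case \<open>j = i\<close> serves a single
  row.\<close>

lemma trace_power_row_dead_end:
  assumes "h \<in> set \<gamma>" "h \<noteq> i" "h \<noteq> j" "\<And>x y. x \<notin> {i, j} \<Longrightarrow> Poly_Mapping.lookup u (x, y) = 0"
  shows "Poly_Mapping.lookup (trace_power n r) (u + arcs (map (Pair i) \<gamma>)) = 0"
  by (rule trace_power_dead_end[of _ i h])
    (use assms in \<open>auto simp: lookup_add lookup_arcs_row count_list_0_iff\<close>)

text \<open>The weight (k-1)! of differentiating a power of one variable cancels the normalising
  factor of \<open>trace_summand\<close> for a row with multiplicity 1.\<close>

lemma row_operator_trace_power: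
  assumes "i < n" "2 \<le> k"
  shows "Poly_Mapping.lookup (row_operator n k T i (trace_power n (k - 1))) 0 =
    fact (k - 1) * T (replicate k i)"
proof -
  have k: "i # replicate (k - 1) i = replicate k i"
    using assms(2) by (cases k) auto
  have "Poly_Mapping.lookup (row_operator n k T i (trace_power n (k - 1))) 0 =
    T (i # replicate (k - 1) i) * (derivative_weight 0 (replicate (k - 1) (i, i)) *
       Poly_Mapping.lookup (trace_power n (k - 1)) (0 + arcs (replicate (k - 1) (i, i))))"
  proof (rule lookup_row_operator_single[OF assms(1)])
    fix \<gamma> assume "\<gamma> \<in> row_indices n k" "\<gamma> \<noteq> replicate (k - 1) i"
    then obtain h where "h \<in> set \<gamma>" "h \<noteq> i" using not_replicate_ex[of \<gamma> "k - 1" i] by auto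
    then show "T (i # \<gamma>) * Poly_Mapping.lookup (trace_power n (k - 1)) (0 + arcs (map (Pair i) \<gamma>)) = 0"
      using trace_power_row_dead_end[of h \<gamma> i i 0 n "k - 1"] by simp
  qed
  then show ?thesis
    unfolding k using assms trace_power_loop[OF assms(1), of "k - 1"] by (simp add: derivative_weight_replicate)
qed

lemma row_operator_twice_trace_power:
  assumes "i < n" "2 \<le> k"
  shows "Poly_Mapping.lookup (row_operator n k T i (row_operator n k T i (trace_power n (2 * (k - 1))))) 0 =
    fact (2 * (k - 1)) * (T (replicate k i))\<^sup>2"
proof -
  let ?P = "trace_power n (2 * (k - 1))"
  let ?r = "replicate (k - 1) (i, i)"
  have k: "i # replicate (k - 1) i = replicate k i"
    using assms(2) by (cases k) auto
  have r: "?r @ ?r = replicate (2 * (k - 1)) (i, i)"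
    unfolding mult_2 replicate_add ..
  \<comment> \<open>The outer operator reads the inner one at the monomial of its own arcs, so the
    collapse of the inner sum is needed for every outer multi-index.\<close>
  have 1: "Poly_Mapping.lookup (row_operator n k T i ?P) (arcs (map (Pair i) \<gamma>)) =
      T (i # replicate (k - 1) i) * (derivative_weight (arcs (map (Pair i) \<gamma>)) ?r *
       Poly_Mapping.lookup ?P (arcs (map (Pair i) \<gamma>) + arcs ?r))" for \<gamma>
  proof (rule lookup_row_operator_single[OF assms(1)])
    fix \<gamma>' assume "\<gamma>' \<in> row_indices n k" "\<gamma>' \<noteq> replicate (k - 1) i"
    then obtain h where h: "h \<in> set \<gamma>'" "h \<noteq> i" using not_replicate_ex[of \<gamma>' "k - 1" i] by auto
    have "Poly_Mapping.lookup ?P (arcs (map (Pair i) \<gamma>) + arcs (map (Pair i) \<gamma>')) = 0"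
      by (rule trace_power_row_dead_end[OF h h(2)]) (simp add: lookup_arcs_row)
    then show "T (i # \<gamma>') * Poly_Mapping.lookup ?P (arcs (map (Pair i) \<gamma>) + arcs (map (Pair i) \<gamma>')) = 0"
      by simp
  qed
  have "Poly_Mapping.lookup (row_operator n k T i (row_operator n k T i ?P)) 0 =
    T (i # replicate (k - 1) i) * (derivative_weight 0 ?r *
       Poly_Mapping.lookup (row_operator n k T i ?P) (0 + arcs ?r))"
  proof (rule lookup_row_operator_single[OF assms(1)])
    fix \<gamma> assume "\<gamma> \<in> row_indices n k" "\<gamma> \<noteq> replicate (k - 1) i"
    then obtain h where h: "h \<in> set \<gamma>" "h \<noteq> i" using not_replicate_ex[of \<gamma> "k - 1" i] by auto
    have "Poly_Mapping.lookup ?P (arcs ?r + arcs (map (Pair i) \<gamma>)) = 0"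
      by (rule trace_power_row_dead_end[OF h h(2)]) (simp add: lookup_arcs count_list_replicate)
    then show "T (i # \<gamma>) * Poly_Mapping.lookup (row_operator n k T i ?P) (0 + arcs (map (Pair i) \<gamma>)) = 0"
      unfolding add_0_left 1 by (simp only: add.commute mult_zero_right)
  qed
  also have "\<dots> = T (replicate k i) * (derivative_weight 0 ?r * (T (replicate k i) * (derivative_weight (arcs ?r) ?r *
       Poly_Mapping.lookup ?P (arcs ?r + arcs ?r))))"
    unfolding add_0_left 1[of "replicate (k - 1) i", unfolded map_replicate] k ..
  also have "\<dots> = (T (replicate k i))\<^sup>2 * derivative_weight 0 (?r @ ?r) * Poly_Mapping.lookup ?P (arcs (?r @ ?r))"
    by (simp add: derivative_weight_append power2_eq_square)
  also have "\<dots> = fact (2 * (k - 1)) * (T (replicate k i))\<^sup>2"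
    unfolding r derivative_weight_replicate using assms trace_power_loop[OF assms(1), of "2 * (k - 1)"] by simp
  finally show ?thesis .
qed

lemma A_alpha_diag:
  assumes "uniform k H" "2 \<le> k"
  shows "A_alpha \<alpha> k H (replicate k i) = \<alpha> * real (vdegree H i)"
proof -
  have "{i} \<notin> hedges H" using assms by (auto simp: uniform_def)
  moreover have "replicate k i \<noteq> []" "set (replicate k i) = {i}" using assms(2) by auto
  ultimately show ?thesis
    by (auto simp: A_alpha_def degree_tensor_def adjacency_tensor_def)
qed

lemma A_alpha_off_diag:
  assumes "A_alpha \<alpha> k H (i # \<gamma>) \<noteq> 0" "length \<gamma> = k - 1" "\<gamma> \<noteq> replicate (k - 1) i"
  shows "insert i (set \<gamma>) \<in> hedges H"
  using assms not_replicate_ex[OF assms(2,3)]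
  by (auto simp: A_alpha_def degree_tensor_def adjacency_tensor_def split: if_splits)

lemma A_alpha_edge:
  assumes "i \<noteq> j"
  shows "A_alpha \<alpha> 2 H [i, j] = (1 - \<alpha>) * of_bool ({i, j} \<in> hedges H)"
  using assms by (auto simp: A_alpha_def degree_tensor_def adjacency_tensor_def)

text \<open>If both multi-indices are constant, the arcs are loops at two vertices, which no walk
  connects. Otherwise a nonzero entry spans a hyperedge with at least three vertices, and one of
  them differs from \<open>i\<close> and \<open>j\<close>, hence is a dead end. The constant
  \<open>c\<close> stands for the normalising factor that \<open>trace_summand\<close> inserts
  between the two rows.\<close>

lemma row_operators_trace_power_ge3:
  assumes "uniform k H" "3 \<le> k" "i \<noteq> j" "i < n" "j < n"
  shows "Poly_Mapping.lookup (row_operator n k (A_alpha \<alpha> k H) j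
     (Const c * row_operator n k (A_alpha \<alpha> k H) i (trace_power n r))) 0 = 0"
proof -
  let ?T = "A_alpha \<alpha> k H"
  have third: "\<exists>h\<in>set \<gamma>. h \<noteq> x \<and> h \<noteq> y"
    if "?T (x # \<gamma>) \<noteq> 0" "length \<gamma> = k - 1" "\<gamma> \<noteq> replicate (k - 1) x" for x y \<gamma>
  proof (rule ccontr)
    assume "\<not> (\<exists>h\<in>set \<gamma>. h \<noteq> x \<and> h \<noteq> y)"
    then have "insert x (set \<gamma>) \<subseteq> {x, y}" by auto
    then have "card (insert x (set \<gamma>)) \<le> card {x, y}"
      by (rule card_mono[rotated]) auto
    also have "\<dots> \<le> 2" by (simp add: card_insert_if)
    finally show False
      using A_alpha_off_diag[OF that] assms(1,2) by (auto simp: uniform_def)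
  qed
  have "?T (j # \<gamma>) * (derivative_weight 0 (map (Pair j) \<gamma>) * (c * (?T (i # \<gamma>') *
      (derivative_weight (arcs (map (Pair j) \<gamma>)) (map (Pair i) \<gamma>') *
       Poly_Mapping.lookup (trace_power n r) (arcs (map (Pair j) \<gamma>) + arcs (map (Pair i) \<gamma>')))))) = 0"
    if \<gamma>: "length \<gamma> = k - 1" and \<gamma>': "length \<gamma>' = k - 1" for \<gamma> \<gamma>'
  proof (cases "?T (j # \<gamma>) = 0 \<or> ?T (i # \<gamma>') = 0")
    case False
    have "Poly_Mapping.lookup (trace_power n r) (arcs (map (Pair j) \<gamma>) + arcs (map (Pair i) \<gamma>')) = 0"
    proof (cases "\<gamma> = replicate (k - 1) j")
      case g: True
      show ?thesis
      proof (cases "\<gamma>' = replicate (k - 1) i")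
        case True
        show ?thesis
          by (rule trace_power_two_loops[where i = i and j = j])
            (use assms g True in \<open>auto simp: lookup_add lookup_arcs count_list_replicate map_replicate split: if_splits\<close>)
      next
        case False
        with third[of i \<gamma>' j] \<open>\<not> (?T (j # \<gamma>) = 0 \<or> ?T (i # \<gamma>') = 0)\<close> \<gamma>'
        obtain h where h: "h \<in> set \<gamma>'" "h \<noteq> i" "h \<noteq> j" by blast
        show ?thesis
          by (rule trace_power_row_dead_end[OF h]) (simp add: lookup_arcs_row)
      qed
    next
      case g: False
      with third[of j \<gamma> i] \<open>\<not> (?T (j # \<gamma>) = 0 \<or> ?T (i # \<gamma>') = 0)\<close> \<gamma>
      obtain h where h: "h \<in> set \<gamma>" "h \<noteq> j" "h \<noteq> i" by blast
      show ?thesis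
        by (subst add.commute, rule trace_power_row_dead_end[OF h]) (simp add: lookup_arcs_row)
    qed
    then show ?thesis by simp
  qed auto
  then show ?thesis
    unfolding lookup_row_operator lookup_Const_times sum_distrib_left
    by (intro sum.neutral ballI) simp
qed

lemma row_indices_2: "{\<gamma>. length \<gamma> = Suc 0 \<and> set \<gamma> \<subseteq> {..<n}} = (\<lambda>x. [x]) ` {..<n}"
  by (auto simp: length_Suc_conv)

text \<open>Of all arcs \<open>(j, x)\<close> and \<open>(i, y)\<close> only \<open>x = i\<close>,
  \<open>y = j\<close> form a closed walk. It picks up the two adjacency entries of the edge, and 2
  is the number of its starting points.\<close>

lemma row_operators_trace_power_2:
  assumes "i \<noteq> j" "i < n" "j < n"
  shows "Poly_Mapping.lookup (row_operator n 2 (A_alpha \<alpha> 2 H) j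
     (row_operator n 2 (A_alpha \<alpha> 2 H) i (trace_power n 2))) 0 =
     2 * (1 - \<alpha>)\<^sup>2 * of_bool ({i, j} \<in> hedges H)"
proof -
  let ?T = "A_alpha \<alpha> 2 H"
  have zero: "Poly_Mapping.lookup (trace_power n 2) (arc (j, x) + arc (i, y)) = 0" if xy: "x \<noteq> i \<or> y \<noteq> j" for x y
  proof -
    \<comment> \<open>A head outside \<open>i\<close> and \<open>j\<close> is a dead end; otherwise
      there are two separate loops, or one loop and an arc into its vertex whose tail is never
      entered.\<close>
    consider "x \<notin> {i, j}" | "y \<notin> {i, j}" | "x = j" "y = i" | "x = j" "y = j" | "x = i" "y = i"
      using xy by blast
    then show ?thesis
    proof cases
      case 1
      show ?thesis
        by (rule trace_power_dead_end[of _ j x]) (use 1 assms in \<open>auto simp: lookup_add lookup_arc\<close>)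
    next
      case 2
      show ?thesis
        by (rule trace_power_dead_end[of _ i y]) (use 2 assms in \<open>auto simp: lookup_add lookup_arc\<close>)
    next
      case 3
      show ?thesis
        by (rule trace_power_two_loops[where i = i and j = j])
          (use 3 assms in \<open>auto simp: lookup_add lookup_arc split: if_splits\<close>)
    next
      case 4
      show ?thesis
        by (rule trace_power_dead_start[of _ i j]) (use 4 assms in \<open>auto simp: lookup_add lookup_arc\<close>)
    next
      case 5
      show ?thesis
        by (rule trace_power_dead_start[of _ j i]) (use 5 assms in \<open>auto simp: lookup_add lookup_arc\<close>)
    qed
  qed
  have inj: "inj_on (\<lambda>x. [x]) {..<n}" by (rule inj_onI) simp
  have "Poly_Mapping.lookup (row_operator n 2 ?T j (row_operator n 2 ?T i (trace_power n 2))) 0 =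
    (\<Sum>x<n. \<Sum>y<n. ?T [j, x] * (?T [i, y] * (derivative_weight (arc (j, x)) [(i, y)] *
      Poly_Mapping.lookup (trace_power n 2) (arc (j, x) + arc (i, y)))))"
    by (simp add: lookup_row_operator row_indices_2 sum.reindex[OF inj] sum_distrib_left)
  also have "\<dots> = (\<Sum>x<n. \<Sum>y<n. if y = j then if x = i then ?T [j, i] * ?T [i, j] * 2 else 0 else 0)"
    using zero trace_power_2_edge[OF assms(2,3,1)] assms
    by (intro sum.cong refl) (auto simp: lookup_arc)
  also have "\<dots> = ?T [j, i] * ?T [i, j] * 2"
    using assms by simp
  also have "\<dots> = 2 * (1 - \<alpha>)\<^sup>2 * of_bool ({i, j} \<in> hedges H)"
    using assms by (simp add: A_alpha_edge insert_commute power2_eq_square)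
  finally show ?thesis .
qed

section \<open>The trace formula for d = 1 and d = 2\<close>

lemma fold_eq_id: "(\<And>x. x \<in> set xs \<Longrightarrow> f x = (\<lambda>p. p)) \<Longrightarrow> fold f xs = (\<lambda>p. p)"
  by (induction xs) (auto simp: fun_eq_iff)

lemma upt_split: "m \<le> i \<Longrightarrow> i < n \<Longrightarrow> [m..<n] = [m..<i] @ i # [Suc i..<n]"
  using upt_add_eq_append[of m i "n - i"] by (simp add: upt_conv_Cons)

lemma fold_upt_single:
  assumes "i < n" "\<And>x. x < n \<Longrightarrow> x \<noteq> i \<Longrightarrow> f x = (\<lambda>p. p)"
  shows "fold f [0..<n] p = f i p"
proof -
  have "fold f [0..<i] = (\<lambda>p. p)" "fold f [Suc i..<n] = (\<lambda>p. p)"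
    using assms by (auto intro!: fold_eq_id)
  then show ?thesis by (simp add: upt_split[of 0 i n] assms(1))
qed

lemma fold_upt_pair:
  assumes "i < j" "j < n" "\<And>x. x < n \<Longrightarrow> x \<noteq> i \<Longrightarrow> x \<noteq> j \<Longrightarrow> f x = (\<lambda>p. p)"
  shows "fold f [0..<n] p = f j (f i p)"
proof -
  have "fold f [0..<i] = (\<lambda>p. p)" "fold f [Suc i..<j] = (\<lambda>p. p)" "fold f [Suc j..<n] = (\<lambda>p. p)"
    using assms by (auto intro!: fold_eq_id)
  moreover have "[0..<n] = [0..<i] @ i # [Suc i..<j] @ j # [Suc j..<n]"
    using assms upt_split[of 0 i n] upt_split[of "Suc i" j n] by simp
  ultimately show ?thesis by simp
qed

lemma Const_1: "Const 1 = 1"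
  by (simp add: Const_def)

definition point_list :: "nat \<Rightarrow> nat \<Rightarrow> nat \<Rightarrow> nat list" where
  "point_list n c i = map (\<lambda>x. if x = i then c else 0) [0..<n]"

definition pair_list :: "nat \<Rightarrow> nat \<times> nat \<Rightarrow> nat list" where
  "pair_list n ij = map (\<lambda>x. if x = fst ij \<or> x = snd ij then 1 else 0) [0..<n]"

lemma trace_summand_point:
  assumes "i < n"
  shows "trace_summand n k T d (point_list n c i) =
    Const (1 / fact (c * (k - 1))) * (row_operator n k T i ^^ c) (trace_power n (d * (k - 1)))"
  unfolding trace_summand_def
  by (subst fold_upt_single[OF assms]) (auto simp: point_list_def Const_1 assms)

text \<open>\<open>fold\<close> runs upwards through the rows, so the smaller index \<open>i\<close>
  acts first and stands innermost.\<close>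

lemma trace_summand_pair:
  assumes "i < j" "j < n"
  shows "trace_summand n k T d (pair_list n (i, j)) =
    Const (1 / fact (k - 1)) * row_operator n k T j
      (Const (1 / fact (k - 1)) * row_operator n k T i (trace_power n (d * (k - 1))))"
  unfolding trace_summand_def
  by (subst fold_upt_pair[OF assms]) (use assms in \<open>auto simp: pair_list_def Const_1\<close>)

lemma sum_list_point_list: "i < n \<Longrightarrow> sum_list (point_list n c i) = c"
  by (simp add: point_list_def interv_sum_list_conv_sum_set_nat)

lemma sum_list_pair_list:
  assumes "i < j" "j < n"
  shows "sum_list (pair_list n (i, j)) = 2"
proof -
  have "sum_list (pair_list n (i, j)) = (\<Sum>x = 0..<n. if x = i \<or> x = j then 1 else 0)"
    by (simp add: pair_list_def interv_sum_list_conv_sum_set_nat)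
  also have "\<dots> = (\<Sum>x\<in>{i, j}. 1)"
    by (rule sum.mono_neutral_cong_right) (use assms in auto)
  finally show ?thesis using assms by simp
qed

lemma length_point_list: "length (point_list n c i) = n"
  by (simp add: point_list_def)

lemma length_pair_list: "length (pair_list n ij) = n"
  by (simp add: pair_list_def)

lemma compositions_1:
  "{ds. length ds = n \<and> sum_list ds = 1} = point_list n 1 ` {..<n}"
proof
  show "{ds. length ds = n \<and> sum_list ds = 1} \<subseteq> point_list n 1 ` {..<n}"
  proof
    fix ds assume "ds \<in> {ds. length ds = n \<and> sum_list ds = (1::nat)}"
    then have n: "length ds = n" and s: "(\<Sum>x<n. ds ! x) = 1"
      by (auto simp: sum_list_sum_nth lessThan_atLeast0)
    from s obtain i where i: "i \<in> {..<n}" "ds ! i = 1" "\<forall>x\<in>{..<n}. i \<noteq> x \<longrightarrow> ds ! x = 0"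
      unfolding sum_eq_1_iff[OF finite_lessThan] by blast
    then have "ds = point_list n 1 i"
      using n by (auto simp: point_list_def intro!: nth_equalityI)
    with i(1) show "ds \<in> point_list n 1 ` {..<n}" by blast
  qed
qed (auto simp: sum_list_point_list length_point_list)

lemma compositions_2:
  "{ds. length ds = n \<and> sum_list ds = 2} =
    point_list n 2 ` {..<n} \<union> pair_list n ` {(i, j). i < j \<and> j < n}"
proof
  show "{ds. length ds = n \<and> sum_list ds = 2} \<subseteq>
    point_list n 2 ` {..<n} \<union> pair_list n ` {(i, j). i < j \<and> j < n}"
  proof
    fix ds assume "ds \<in> {ds. length ds = n \<and> sum_list ds = (2::nat)}"
    then have n: "length ds = n" and s: "(\<Sum>x<n. ds ! x) = 2"
      by (auto simp: sum_list_sum_nth lessThan_atLeast0)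
    have "\<not> (\<forall>x\<in>{..<n}. ds ! x = 0)"
    proof
      assume "\<forall>x\<in>{..<n}. ds ! x = 0"
      with s show False by simp
    qed
    then obtain i where i: "i < n" "ds ! i \<noteq> 0" by auto
    then have r: "ds ! i + (\<Sum>x\<in>{..<n} - {i}. ds ! x) = 2"
      using s by (simp add: sum.remove)
    show "ds \<in> point_list n 2 ` {..<n} \<union> pair_list n ` {(i, j). i < j \<and> j < n}"
    proof (cases "ds ! i = 1")
      case True
      with r have "(\<Sum>x\<in>{..<n} - {i}. ds ! x) = 1" by simp
      then obtain j where j: "j \<in> {..<n} - {i}" "ds ! j = 1"
        "\<forall>x\<in>{..<n} - {i}. j \<noteq> x \<longrightarrow> ds ! x = 0"
        unfolding sum_eq_1_iff[OF finite_Diff[OF finite_lessThan]] by blast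
      have "ds = pair_list n (min i j, max i j)"
        using n i j True by (auto simp: pair_list_def min_def max_def intro!: nth_equalityI)
      moreover have "(min i j, max i j) \<in> {(i, j). i < j \<and> j < n}"
        using i j by auto
      ultimately show ?thesis by blast
    next
      case False
      then have "ds ! i = 2" "(\<Sum>x\<in>{..<n} - {i}. ds ! x) = 0" using r i(2) by linarith+
      then have "ds = point_list n 2 i"
        using n i by (auto simp: point_list_def intro!: nth_equalityI)
      with i(1) show ?thesis by blast
    qed
  qed
qed (auto simp: sum_list_point_list length_point_list sum_list_pair_list length_pair_list)

lemma inj_point_list: "c \<noteq> 0 \<Longrightarrow> inj_on (point_list n c) {..<n}"
proof (rule inj_onI)
  fix i j assume "c \<noteq> 0" "i \<in> {..<n}" "j \<in> {..<n}" "point_list n c i = point_list n c j"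
  then have "point_list n c i ! i = point_list n c j ! i" "i < n" by auto
  then show "i = j" using \<open>c \<noteq> 0\<close> by (auto simp: point_list_def split: if_splits)
qed

lemma inj_pair_list: "inj_on (pair_list n) {(i, j). i < j \<and> j < n}"
proof (rule inj_onI, clarify)
  fix i j i' j' assume *: "i < j" "j < n" "i' < j'" "j' < n" and eq: "pair_list n (i, j) = pair_list n (i', j')"
  have "x = i \<or> x = j \<longleftrightarrow> x = i' \<or> x = j'" if "x < n" for x
    using arg_cong[OF eq, of "\<lambda>ds. ds ! x"] that by (auto simp: pair_list_def split: if_splits)
  from this[of i] this[of j] this[of i'] this[of j'] * show "i = i' \<and> j = j'" by auto
qed

lemma point_list_pair_list_disjoint:
  "point_list n 2 ` {..<n} \<inter> pair_list n ` {(i, j). i < j \<and> j < n} = {}"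
proof -
  have False if "point_list n 2 a = pair_list n (i, j)" "a < n" for a i j
    using arg_cong[OF that(1), of "\<lambda>ds. ds ! a"] that(2)
    by (auto simp: point_list_def pair_list_def split: if_splits)
  then show ?thesis by (intro equals0I) (elim IntE imageE, clarsimp, metis)
qed

lemma Tr_1_A_alpha:
  assumes "uniform k H" "2 \<le> k"
  shows "Tr n k 1 (A_alpha \<alpha> k H) = real ((k - 1) ^ (n - 1)) * (\<alpha> * real (\<Sum>v<n. vdegree H v))"
proof -
  have "(\<Sum>ds | length ds = n \<and> sum_list ds = 1.
      Poly_Mapping.lookup (trace_summand n k (A_alpha \<alpha> k H) 1 ds) 0) = (\<Sum>v<n. \<alpha> * real (vdegree H v))"
    unfolding compositions_1 sum.reindex[OF inj_point_list[OF one_neq_zero]] comp_def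
  proof (rule sum.cong[OF refl])
    fix v assume "v \<in> {..<n}"
    then show "Poly_Mapping.lookup (trace_summand n k (A_alpha \<alpha> k H) 1 (point_list n 1 v)) 0 = \<alpha> * real (vdegree H v)"
      using row_operator_trace_power[of v n k "A_alpha \<alpha> k H"] A_alpha_diag[OF assms] assms(2)
      by (simp add: trace_summand_point lookup_Const_times)
  qed
  then show ?thesis unfolding Tr_def by (simp add: sum_distrib_left)
qed

lemma card_edges_pairs:
  fixes H :: "nat hypergraph"
  assumes "uniform 2 H" "\<And>e. e \<in> hedges H \<Longrightarrow> e \<subseteq> {..<n}"
  shows "card {(i, j). i < j \<and> j < n \<and> {i, j} \<in> hedges H} = card (hedges H)"
proof (rule bij_betw_same_card[of "\<lambda>(i, j). {i, j}"], rule bij_betw_imageI)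
  show "inj_on (\<lambda>(i, j). {i, j}) {(i, j). i < j \<and> j < n \<and> {i, j} \<in> hedges H}"
    by (rule inj_onI) (auto simp: doubleton_eq_iff)
  show "(\<lambda>(i, j). {i, j}) ` {(i, j). i < j \<and> j < n \<and> {i, j} \<in> hedges H} = hedges H"
  proof
    show "hedges H \<subseteq> (\<lambda>(i, j). {i, j}) ` {(i, j). i < j \<and> j < n \<and> {i, j} \<in> hedges H}"
    proof
      fix e assume e: "e \<in> hedges H"
      then have "card e = 2" using assms(1) by (simp add: uniform_def)
      then obtain x y where xy: "e = {x, y}" "x \<noteq> y" by (meson card_2_iff)
      with assms(2)[OF e] have "x < n" "y < n" by auto
      then have "(min x y, max x y) \<in> {(i, j). i < j \<and> j < n \<and> {i, j} \<in> hedges H}"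
        using xy e by (auto simp: min_def max_def insert_commute)
      moreover have "e = (\<lambda>(i, j). {i, j}) (min x y, max x y)"
        using xy by (auto simp: min_def max_def)
      ultimately show "e \<in> (\<lambda>(i, j). {i, j}) ` {(i, j). i < j \<and> j < n \<and> {i, j} \<in> hedges H}"
        by (rule rev_image_eqI)
    qed
  qed auto
qed

text \<open>For \<open>k = 2\<close> this is the trace of the square of a symmetric matrix, to which
  an edge contributes its two off-diagonal entries squared. That extra term depends on the number of
  edges only, so it cancels in comparisons within the class.\<close>

lemma Tr_2_A_alpha:
  assumes "uniform k H" "2 \<le> k" "\<And>e. e \<in> hedges H \<Longrightarrow> e \<subseteq> {..<n}"
  shows "Tr n k 2 (A_alpha \<alpha> k H) = real ((k - 1) ^ (n - 1)) *
    (\<alpha>\<^sup>2 * real (\<Sum>v<n. (vdegree H v)\<^sup>2) + (if k = 2 then 2 * (1 - \<alpha>)\<^sup>2 * real (card (hedges H)) else 0))"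
proof -
  let ?F = "\<lambda>ds. Poly_Mapping.lookup (trace_summand n k (A_alpha \<alpha> k H) 2 ds) 0"
  let ?I = "{(i, j). i < j \<and> j < n}"
  have fin: "finite ?I" by (rule finite_subset[of _ "{..<n} \<times> {..<n}"]) auto
  have "sum ?F {ds. length ds = n \<and> sum_list ds = 2} =
    sum ?F (point_list n 2 ` {..<n}) + sum ?F (pair_list n ` ?I)"
    unfolding compositions_2
    by (rule sum.union_disjoint) (use fin point_list_pair_list_disjoint in auto)
  also have "sum ?F (point_list n 2 ` {..<n}) = (\<Sum>v<n. \<alpha>\<^sup>2 * (real (vdegree H v))\<^sup>2)"
    unfolding sum.reindex[OF inj_point_list[OF zero_neq_numeral[symmetric]]] comp_def
  proof (rule sum.cong[OF refl])
    fix v assume "v \<in> {..<n}"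
    then show "?F (point_list n 2 v) = \<alpha>\<^sup>2 * (real (vdegree H v))\<^sup>2"
      using row_operator_twice_trace_power[of v n k "A_alpha \<alpha> k H"] A_alpha_diag[OF assms(1,2)] assms(2)
      by (simp add: trace_summand_point lookup_Const_times power_mult_distrib numeral_2_eq_2)
  qed
  also have "sum ?F (pair_list n ` ?I) = (\<Sum>ij\<in>?I. ?F (pair_list n ij))"
    by (simp add: sum.reindex[OF inj_pair_list])
  also have "\<dots> = (if k = 2 then 2 * (1 - \<alpha>)\<^sup>2 * real (card (hedges H)) else 0)"
  proof (cases "k = 2")
    case True
    have "(\<Sum>ij\<in>?I. ?F (pair_list n ij)) =
      (\<Sum>ij\<in>?I. if ij \<in> {(i, j). {i, j} \<in> hedges H} then 2 * (1 - \<alpha>)\<^sup>2 else 0)"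
    proof (rule sum.cong[OF refl])
      fix ij assume "ij \<in> ?I"
      then obtain i j where ij: "ij = (i, j)" "i < j" "j < n" by auto
      show "?F (pair_list n ij) = (if ij \<in> {(i, j). {i, j} \<in> hedges H} then 2 * (1 - \<alpha>)\<^sup>2 else 0)"
        using row_operators_trace_power_2[of i j n \<alpha> H] ij True
        by (simp add: trace_summand_pair lookup_Const_times Const_1)
    qed
    also have "\<dots> = 2 * (1 - \<alpha>)\<^sup>2 * real (card (?I \<inter> {(i, j). {i, j} \<in> hedges H}))"
      by (simp add: sum.If_cases[OF fin])
    also have "?I \<inter> {(i, j). {i, j} \<in> hedges H} = {(i, j). i < j \<and> j < n \<and> {i, j} \<in> hedges H}"
      by auto
    finally show ?thesis
      using True assms card_edges_pairs[of H n] by simp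
  next
    case False
    have "?F (pair_list n ij) = 0" if "ij \<in> ?I" for ij
    proof -
      from that obtain i j where ij: "ij = (i, j)" "i < j" "j < n" by auto
      show ?thesis
        using row_operators_trace_power_ge3[OF assms(1), of i j n \<alpha> "1 / fact (k - 1)" "2 * (k - 1)"] ij False assms(2)
        by (simp add: trace_summand_pair lookup_Const_times)
    qed
    then show ?thesis using False by simp
  qed
  finally show ?thesis
    unfolding Tr_def by (simp add: sum_distrib_left)
qed

section \<open>Counting incidences of unicyclic hypergraphs\<close>

definition incidences :: "'a hypergraph \<Rightarrow> ('a \<times> 'a set) set" where
  "incidences H = {(v, e). e \<in> hedges H \<and> v \<in> e}"

text \<open>Cycles are taken relative to a set of incidences, because they are also needed for a
  tree of incidences and for a tree with one incidence added, neither of which need be all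
  incidences of a hypergraph.\<close>

definition cycle_in :: "('a \<times> 'a set) set \<Rightarrow> 'a list \<Rightarrow> 'a set list \<Rightarrow> bool" where
  "cycle_in I vs es \<longleftrightarrow> length es = length vs \<and> 2 \<le> length vs \<and> distinct vs \<and> distinct es \<and>
     cycle_incidences vs es \<subseteq> I"

lemma is_cycle_iff_cycle_in: "is_cycle H vs es \<longleftrightarrow> cycle_in (incidences H) vs es"
  unfolding is_cycle_def cycle_in_def incidences_def cycle_incidences_def
  by (fastforce simp: set_conv_nth)

text \<open>With \<open>cycle_incidences_vertex\<close> this says that both kinds of nodes on a
  cycle have at least two incidences on it, so that a leaf of the incidence graph never lies on a
  cycle.\<close>

lemma cycle_incidences_edge:
  assumes "cycle_in I vs es" "(v, e) \<in> cycle_incidences vs es"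
  shows "\<exists>v'. v' \<noteq> v \<and> (v', e) \<in> cycle_incidences vs es"
proof -
  let ?n = "length vs"
  from assms(2) obtain i where i: "i < ?n" "e = es ! i" "v = vs ! i \<or> v = vs ! (Suc i mod ?n)"
    by (auto simp: cycle_incidences_def)
  have "i \<noteq> Suc i mod ?n" "Suc i mod ?n < ?n"
    using i(1) assms(1) by (auto simp: cycle_in_def mod_Suc)
  then have "vs ! i \<noteq> vs ! (Suc i mod ?n)"
    using i(1) assms(1) by (simp add: cycle_in_def nth_eq_iff_index_eq)
  moreover have "(vs ! i, e) \<in> cycle_incidences vs es" "(vs ! (Suc i mod ?n), e) \<in> cycle_incidences vs es"
    using i by (auto simp: cycle_incidences_def)
  ultimately show ?thesis using i(3) by metis
qed

lemma cycle_incidences_vertex: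
  assumes "cycle_in I vs es" "v \<in> set vs"
  obtains e e' where "e \<noteq> e'" "(v, e) \<in> cycle_incidences vs es" "(v, e') \<in> cycle_incidences vs es"
proof -
  let ?n = "length vs"
  from assms(2) obtain j where j: "j < ?n" "v = vs ! j" by (metis in_set_conv_nth)
  define i where "i = (if j = 0 then ?n - 1 else j - 1)"
  have i: "i < ?n" "Suc i mod ?n = j" "i \<noteq> j"
    using j assms(1) by (auto simp: i_def cycle_in_def)
  show thesis
  proof (rule that)
    show "es ! i \<noteq> es ! j"
      using i j assms(1) by (simp add: cycle_in_def nth_eq_iff_index_eq)
    show "(v, es ! i) \<in> cycle_incidences vs es" "(v, es ! j) \<in> cycle_incidences vs es"
      using i j by (auto simp: cycle_incidences_def)
  qed
qed

lemma cycle_incidences_in_set: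
  assumes "cycle_in I vs es" "(v, e) \<in> cycle_incidences vs es"
  shows "v \<in> set vs" "e \<in> set es"
  using assms by (auto simp: cycle_in_def cycle_incidences_def intro!: nth_mem mod_less_divisor)

lemma snd_cycle_incidences:
  assumes "cycle_in I vs es"
  shows "snd ` cycle_incidences vs es = set es"
proof
  show "set es \<subseteq> snd ` cycle_incidences vs es"
  proof
    fix e assume "e \<in> set es"
    then obtain i where "i < length vs" "e = es ! i"
      using assms by (auto simp: cycle_in_def in_set_conv_nth)
    then have "(vs ! i, e) \<in> cycle_incidences vs es" by (auto simp: cycle_incidences_def)
    then show "e \<in> snd ` cycle_incidences vs es" by force
  qed
qed (use assms cycle_incidences_in_set in force)

text \<open>\<open>Inl\<close> nodes of the bipartite incidence graph are vertices, \<open>Inr\<close> nodes are hyperedges.\<close>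

fun adjacent :: "('a \<times> 'b) set \<Rightarrow> 'a + 'b \<Rightarrow> 'a + 'b \<Rightarrow> bool" where
  "adjacent T (Inl v) (Inr e) \<longleftrightarrow> (v, e) \<in> T"
| "adjacent T (Inr e) (Inl v) \<longleftrightarrow> (v, e) \<in> T"
| "adjacent T _ _ \<longleftrightarrow> False"

text \<open>A tree is represented by a history of attaching leaves: \<open>S\<close> collects the
  nodes, \<open>T\<close> the incidences. Its size, its acyclicity and its paths then all follow by
  induction over the history.\<close>

inductive grown_tree :: "('a \<times> 'b) set \<Rightarrow> ('a + 'b) set \<Rightarrow> ('a \<times> 'b) set \<Rightarrow> bool" for I where
  root: "grown_tree I {Inl v} {}"
| edge: "grown_tree I S T \<Longrightarrow> Inl v \<in> S \<Longrightarrow> Inr e \<notin> S \<Longrightarrow> (v, e) \<in> I \<Longrightarrow>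
    grown_tree I (insert (Inr e) S) (insert (v, e) T)"
| vertex: "grown_tree I S T \<Longrightarrow> Inr e \<in> S \<Longrightarrow> Inl v \<notin> S \<Longrightarrow> (v, e) \<in> I \<Longrightarrow>
    grown_tree I (insert (Inl v) S) (insert (v, e) T)"

lemma grown_tree_subset:
  "grown_tree I S T \<Longrightarrow> T \<subseteq> I \<and> (\<forall>(v, e) \<in> T. Inl v \<in> S \<and> Inr e \<in> S)"
  by (induction rule: grown_tree.induct) auto

lemma grown_tree_card: "grown_tree I S T \<Longrightarrow> finite S \<and> finite T \<and> card S = Suc (card T)"
proof (induction rule: grown_tree.induct)
  case (edge S T v e)
  then have "(v, e) \<notin> T" using grown_tree_subset by fastforce
  with edge show ?case by simp
next
  case (vertex S T e v)
  then have "(v, e) \<notin> T" using grown_tree_subset by fastforce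
  with vertex show ?case by simp
qed simp

text \<open>By induction a cycle must use the incidence added last, but this one leads to a leaf,
  and nodes on a cycle have two incidences on it.\<close>

lemma grown_tree_acyclic: "grown_tree I S T \<Longrightarrow> \<not> cycle_in T vs es"
proof (induction rule: grown_tree.induct)
  case (root v)
  show ?case
    by (auto simp: cycle_in_def cycle_incidences_def intro!: exI[of _ "0::nat"])
next
  case (edge S T v e)
  show ?case
  proof
    assume c: "cycle_in (insert (v, e) T) vs es"
    then have sub: "cycle_incidences vs es \<subseteq> insert (v, e) T" by (simp add: cycle_in_def)
    have "(v, e) \<in> cycle_incidences vs es"
      using edge.IH c sub by (auto simp: cycle_in_def)
    from cycle_incidences_edge[OF c this] sub obtain v' where "(v', e) \<in> T" by auto
    then show False using grown_tree_subset[OF edge.hyps(1)] edge.hyps(3) by auto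
  qed
next
  case (vertex S T e v)
  show ?case
  proof
    assume c: "cycle_in (insert (v, e) T) vs es"
    then have sub: "cycle_incidences vs es \<subseteq> insert (v, e) T" by (simp add: cycle_in_def)
    have "(v, e) \<in> cycle_incidences vs es"
      using vertex.IH c sub by (auto simp: cycle_in_def)
    with cycle_incidences_in_set[OF c] have "v \<in> set vs" by blast
    from cycle_incidences_vertex[OF c this] sub obtain e' where "(v, e') \<in> T"
      by (metis insertE prod.inject subsetD)
    then show False using grown_tree_subset[OF vertex.hyps(1)] vertex.hyps(3) by auto
  qed
qed

section \<open>Tree paths and the cycles they close\<close>

definition simple_path :: "('a \<times> 'b) set \<Rightarrow> ('a + 'b) set \<Rightarrow> 'a + 'b \<Rightarrow> 'a + 'b \<Rightarrow> ('a + 'b) list \<Rightarrow> bool" where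
  "simple_path T S a b p \<longleftrightarrow> p \<noteq> [] \<and> hd p = a \<and> last p = b \<and> distinct p \<and> set p \<subseteq> S \<and>
     successively (adjacent T) p"

lemma adjacent_mono: "adjacent T a b \<Longrightarrow> T \<subseteq> T' \<Longrightarrow> adjacent T' a b"
  by (cases "(T, a, b)" rule: adjacent.cases) auto

lemma adjacent_sym: "adjacent T a b \<Longrightarrow> adjacent T b a"
  by (cases "(T, a, b)" rule: adjacent.cases) auto

lemma simple_path_mono:
  "simple_path T S a b p \<Longrightarrow> T \<subseteq> T' \<Longrightarrow> S \<subseteq> S' \<Longrightarrow> simple_path T' S' a b p"
  unfolding simple_path_def by (auto intro: successively_mono adjacent_mono)

text \<open>Common to both ways of growing a tree: \<open>y\<close> is the new leaf and
  \<open>z\<close> its neighbour, and a path between \<open>y\<close> and an old node is a path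
  between \<open>z\<close> and that node, extended by \<open>y\<close>.\<close>

lemma attach_simple_paths:
  assumes paths: "\<And>a b. a \<in> S \<Longrightarrow> b \<in> S \<Longrightarrow> \<exists>p. simple_path T S a b p"
    and "T \<subseteq> T'" "z \<in> S" "y \<notin> S" "adjacent T' z y" "a \<in> insert y S" "b \<in> insert y S"
  shows "\<exists>p. simple_path T' (insert y S) a b p"
proof -
  have old: "\<exists>p. simple_path T' S a b p" if "a \<in> S" "b \<in> S" for a b
    using paths[OF that] simple_path_mono[OF _ assms(2) order_refl] by blast
  have old': "simple_path T' (insert y S) a b p" if "simple_path T' S a b p" for a b p
    by (rule simple_path_mono[OF that order_refl]) auto
  consider "a \<in> S" "b \<in> S" | "a \<in> S" "b = y" | "a = y" "b \<in> S" | "a = y" "b = y"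
    using assms by blast
  then show ?thesis
  proof cases
    case 1
    then show ?thesis using old old' by blast
  next
    case 2
    then obtain p where "simple_path T' S a z p" using old assms(3) by blast
    then have "simple_path T' (insert y S) a y (p @ [y])"
      using assms(4,5) by (auto simp: simple_path_def successively_append_iff)
    then show ?thesis using 2 by blast
  next
    case 3
    then obtain p where "simple_path T' S z b p" using old assms(3) by blast
    then have "simple_path T' (insert y S) y b (y # p)"
      using assms(4,5) by (auto simp: simple_path_def successively_Cons adjacent_sym)
    then show ?thesis using 3 by blast
  next
    case 4
    then have "simple_path T' (insert y S) a b [y]" by (simp add: simple_path_def)
    then show ?thesis by blast
  qed
qed

lemma grown_tree_path:
  "grown_tree I S T \<Longrightarrow> a \<in> S \<Longrightarrow> b \<in> S \<Longrightarrow> \<exists>p. simple_path T S a b p"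
proof (induction arbitrary: a b rule: grown_tree.induct)
  case (root v)
  then have "simple_path {} {Inl v} a b [Inl v]" by (simp add: simple_path_def)
  then show ?case by blast
next
  case (edge S T v e)
  show ?case
    by (rule attach_simple_paths[OF edge.IH _ edge.hyps(2,3) _ edge.prems]) auto
next
  case (vertex S T e v)
  show ?case
    by (rule attach_simple_paths[OF vertex.IH _ vertex.hyps(2,3) _ vertex.prems]) auto
qed

lemma adjacent_isl: "adjacent T a b \<Longrightarrow> isl b \<longleftrightarrow> \<not> isl a"
  by (cases "(T, a, b)" rule: adjacent.cases) auto

text \<open>The path alternates between vertices at even and hyperedges at odd positions. Running
  from a vertex to a hyperedge it has \<open>2 * n\<close> nodes, and \<open>(v, e)\<close> joins
  its ends.\<close>

lemma simple_path_closes_cycle: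
  assumes p: "simple_path T S (Inl v) (Inr e) p" and "(v, e) \<notin> T"
  obtains vs es where "cycle_in (insert (v, e) T) vs es" "(v, e) \<in> cycle_incidences vs es"
proof -
  have adj: "adjacent T (p ! i) (p ! Suc i)" if "Suc i < length p" for i
    using p that by (simp add: simple_path_def successively_conv_nth)
  have p0: "p ! 0 = Inl v" and plast: "p ! (length p - 1) = Inr e" and "p \<noteq> []"
    using p by (auto simp: simple_path_def hd_conv_nth last_conv_nth)
  have parity: "i < length p \<Longrightarrow> isl (p ! i) \<longleftrightarrow> even i" for i
  proof (induction i)
    case 0
    then show ?case using p0 by simp
  next
    case (Suc i)
    then show ?case using adjacent_isl[OF adj[of i]] by simp
  qed
  have "odd (length p - 1)"
    using parity[of "length p - 1"] plast \<open>p \<noteq> []\<close> by auto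
  then obtain l where l: "length p - 1 = 2 * l + 1" by (rule oddE)
  define n where "n = Suc l"
  have n: "length p = 2 * n" using l \<open>p \<noteq> []\<close> by (cases p) (auto simp: n_def)
  define vs where "vs = map (\<lambda>i. projl (p ! (2 * i))) [0..<n]"
  define es where "es = map (\<lambda>i. projr (p ! (2 * i + 1))) [0..<n]"
  have vs: "Inl (vs ! i) = p ! (2 * i)" if "i < n" for i
    using parity[of "2 * i"] that n by (simp add: vs_def)
  have es: "Inr (es ! i) = p ! (2 * i + 1)" if "i < n" for i
    using parity[of "2 * i + 1"] that n by (simp add: es_def)
  have len: "length vs = n" "length es = n" by (simp_all add: vs_def es_def)
  have dist: "distinct p" using p by (simp add: simple_path_def)
  have ve: "vs ! 0 = v" "es ! (n - 1) = e"
    using vs[of 0] es[of "n - 1"] p0 plast n by (auto simp: n_def)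
  have in1: "(vs ! i, es ! i) \<in> T" if "i < n" for i
    using adj[of "2 * i"] vs[of i, symmetric] es[of i, symmetric] that n by simp
  have in2: "(vs ! Suc i, es ! i) \<in> T" if "Suc i < n" for i
    using adj[of "2 * i + 1"] vs[of "Suc i", symmetric] es[of i, symmetric] that n by simp
  \<comment> \<open>A path of two nodes would consist of the incidence \<open>(v, e)\<close> itself,
    which is not in \<open>T\<close>.\<close>
  have n2: "2 \<le> n"
  proof (rule ccontr)
    assume "\<not> 2 \<le> n"
    then have "n = 1" by (simp add: n_def)
    then show False using in1[of 0] ve assms(2) by simp
  qed
  have "distinct vs"
    unfolding distinct_conv_nth len
  proof (intro allI impI)
    fix i j assume "i < n" "j < n" "i \<noteq> j"
    moreover from this have "p ! (2 * i) \<noteq> p ! (2 * j)"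
      using dist n by (simp add: nth_eq_iff_index_eq)
    ultimately show "vs ! i \<noteq> vs ! j" using vs by metis
  qed
  moreover have "distinct es"
    unfolding distinct_conv_nth len
  proof (intro allI impI)
    fix i j assume "i < n" "j < n" "i \<noteq> j"
    moreover from this have "p ! (2 * i + 1) \<noteq> p ! (2 * j + 1)"
      using dist n by (simp add: nth_eq_iff_index_eq)
    ultimately show "es ! i \<noteq> es ! j" using es by metis
  qed
  \<comment> \<open>Only the wrap-around at the last index uses the added incidence.\<close>
  moreover have "(vs ! i, es ! i) \<in> T \<and> (vs ! (Suc i mod n), es ! i) \<in> insert (v, e) T" if "i < n" for i
  proof (cases "Suc i < n")
    case True
    then show ?thesis using in1[OF that] in2 by simp
  next
    case False
    then have i: "Suc i = n" using that by simp
    then have "i = n - 1" "Suc i mod n = 0" by auto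
    then show ?thesis using in1[OF that] ve by simp
  qed
  then have "cycle_incidences vs es \<subseteq> insert (v, e) T"
    by (auto simp: cycle_incidences_def len)
  ultimately have "cycle_in (insert (v, e) T) vs es"
    using n2 by (simp add: cycle_in_def len)
  moreover have "(v, e) \<in> cycle_incidences vs es"
  proof -
    have "(vs ! (Suc (n - 1) mod n), es ! (n - 1)) \<in> cycle_incidences vs es"
      unfolding cycle_incidences_def len using n2 by (intro UN_I[of "n - 1"]) auto
    moreover have "Suc (n - 1) mod n = 0" using n2 by simp
    ultimately show ?thesis using ve by simp
  qed
  ultimately show thesis by (rule that)
qed

section \<open>Spanning trees and the number of incidences\<close>

lemma grown_tree_root: "grown_tree I S T \<Longrightarrow> \<exists>v. Inl v \<in> S"
  by (induction rule: grown_tree.induct) auto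

text \<open>A grown tree with the most nodes is closed under incidence, since a missing neighbour
  could be attached as a leaf. Connectedness carries this closure to all vertices, and every
  hyperedge contains one.\<close>

lemma connected_spanning_tree:
  assumes "hypergraph H" "connected_hypergraph H" "finite (hedges H)"
  obtains T where "grown_tree (incidences H) (Inl ` verts H \<union> Inr ` hedges H) T"
proof -
  let ?I = "incidences H"
  let ?N = "Inl ` verts H \<union> Inr ` hedges H"
  let ?P = "\<lambda>(S, T). grown_tree ?I S T \<and> S \<subseteq> ?N"
  have finN: "finite ?N" using assms(1,3) by (simp add: hypergraph_def)
  obtain v0 where "v0 \<in> verts H" using assms(2) by (auto simp: connected_hypergraph_def)
  then have "?P ({Inl v0}, {})" by (auto intro: grown_tree.root)
  moreover have "\<forall>y. ?P y \<longrightarrow> card (fst y) < Suc (card ?N)"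
    using card_mono[OF finN] by (auto simp: less_Suc_eq_le)
  ultimately obtain y where y: "?P y" "\<forall>z. ?P z \<longrightarrow> card (fst z) \<le> card (fst y)"
    using ex_has_greatest_nat[of ?P "({Inl v0}, {})" "\<lambda>y. card (fst y)" "Suc (card ?N)"] by blast
  obtain S T where ST: "y = (S, T)" by (cases y)
  have tree: "grown_tree ?I S T" and SN: "S \<subseteq> ?N" using y(1) ST by auto
  have max: "card S' \<le> card S" if "grown_tree ?I S' T'" "S' \<subseteq> ?N" for S' T'
    using y(2) ST that by auto
  have fin: "finite S" using grown_tree_card[OF tree] by blast
  have edge: "Inr e \<in> S" if "Inl v \<in> S" "e \<in> hedges H" "v \<in> e" for v e
  proof (rule ccontr)
    assume *: "Inr e \<notin> S"
    then have "grown_tree ?I (insert (Inr e) S) (insert (v, e) T)"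
      using that by (intro grown_tree.edge[OF tree]) (auto simp: incidences_def)
    moreover have "insert (Inr e) S \<subseteq> ?N"
      using SN that(2) by auto
    ultimately have "card (insert (Inr e) S) \<le> card S" by (rule max)
    then show False using fin * by simp
  qed
  have vertex: "Inl v \<in> S" if "Inr e \<in> S" "e \<in> hedges H" "v \<in> e" for v e
  proof (rule ccontr)
    assume *: "Inl v \<notin> S"
    then have "grown_tree ?I (insert (Inl v) S) (insert (v, e) T)"
      using that by (intro grown_tree.vertex[OF tree]) (auto simp: incidences_def)
    moreover have "insert (Inl v) S \<subseteq> ?N"
      using SN assms(1) that(2,3) by (auto simp: hypergraph_def)
    ultimately have "card (insert (Inl v) S) \<le> card S" by (rule max)
    then show False using fin * by simp
  qed
  obtain r where r: "Inl r \<in> S" using grown_tree_root[OF tree] by blast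
  have reach: "Inl u \<in> S" if "u \<in> verts H" for u
  proof -
    have "(r, u) \<in> {(x, y). \<exists>e \<in> hedges H. x \<in> e \<and> y \<in> e}\<^sup>*"
      using assms(2) r SN that by (auto simp: connected_hypergraph_def)
    then show ?thesis
    proof (induction rule: rtrancl_induct)
      case (step y z)
      then show ?case using edge vertex by blast
    qed (rule r)
  qed
  have "Inr e \<in> S" if "e \<in> hedges H" for e
  proof -
    have "e \<noteq> {}" "e \<subseteq> verts H" using assms(1) that by (auto simp: hypergraph_def)
    then obtain v where "v \<in> e" "v \<in> verts H" by blast
    then show ?thesis using edge reach that by blast
  qed
  then have "S = ?N" using reach SN by auto
  then show thesis using that tree by blast
qed

text \<open>A spanning tree has one incidence fewer than nodes, so exactly one incidence must lie
  off it. At least one does, as the tree is acyclic and a cycle exists. At most one does, as each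
  closes a cycle through itself with no other off-tree incidence, and all these cycles
  coincide.\<close>

lemma unicyclic_card_incidences:
  assumes "hypergraph H" "unicyclic H" "finite (hedges H)"
  shows "card (incidences H) = card (verts H) + card (hedges H)"
proof -
  let ?I = "incidences H"
  let ?N = "Inl ` verts H \<union> Inr ` hedges H"
  have conn: "connected_hypergraph H"
    and uniq: "\<exists>!C. \<exists>vs es. cycle_in ?I vs es \<and> C = cycle_incidences vs es"
    using assms(2) by (auto simp: unicyclic_def is_cycle_iff_cycle_in)
  obtain T where T: "grown_tree ?I ?N T"
    using connected_spanning_tree[OF assms(1) conn assms(3)] by blast
  have finV: "finite (verts H)" using assms(1) by (simp add: hypergraph_def)
  have finT: "finite T" and "card ?N = Suc (card T)" using grown_tree_card[OF T] by auto
  then have cardT: "Suc (card T) = card (verts H) + card (hedges H)"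
    using finV assms(3) by (subst (asm) card_Un_disjoint) (auto simp: card_image)
  have TI: "T \<subseteq> ?I" using grown_tree_subset[OF T] by simp
  have close: "\<exists>vs es. cycle_in ?I vs es \<and> cycle_incidences vs es \<subseteq> insert x T \<and> x \<in> cycle_incidences vs es"
    if x: "x \<in> ?I - T" for x
  proof -
    obtain v e where ve: "x = (v, e)" by (cases x)
    then have "Inl v \<in> ?N" "Inr e \<in> ?N" using x assms(1) by (auto simp: incidences_def hypergraph_def)
    then obtain p where p: "simple_path T ?N (Inl v) (Inr e) p" using grown_tree_path[OF T] by blast
    have "(v, e) \<notin> T" using x ve by simp
    from simple_path_closes_cycle[OF p this] obtain vs es
      where "cycle_in (insert x T) vs es" and x': "x \<in> cycle_incidences vs es"
      using ve by metis
    moreover from this have "cycle_incidences vs es \<subseteq> insert x T" by (simp add: cycle_in_def)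
    moreover have "insert x T \<subseteq> ?I" using x TI by blast
    ultimately have "cycle_in ?I vs es" unfolding cycle_in_def by blast
    with \<open>cycle_incidences vs es \<subseteq> insert x T\<close> x' show ?thesis by blast
  qed
  define C where "C = (THE C. \<exists>vs es. cycle_in ?I vs es \<and> C = cycle_incidences vs es)"
  have unique: "cycle_incidences vs es = C" if "cycle_in ?I vs es" for vs es
    unfolding C_def by (rule the1_equality[OF uniq, symmetric]) (use that in blast)
  from theI'[OF uniq] obtain vs es where C: "cycle_in ?I vs es" by (elim exE conjE)
  have "\<not> cycle_incidences vs es \<subseteq> T"
    using C grown_tree_acyclic[OF T, of vs es] unfolding cycle_in_def by blast
  moreover have "cycle_incidences vs es \<subseteq> ?I" using C by (simp add: cycle_in_def)
  ultimately obtain x where x: "x \<in> ?I - T" by blast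
  have "y = x" if y: "y \<in> ?I - T" for y
  proof -
    from close[OF x] have "C \<subseteq> insert x T" using unique by auto
    moreover from close[OF y] have "y \<in> C" using unique by auto
    ultimately show ?thesis using y by blast
  qed
  then have "?I = insert x T" using x TI by blast
  then have "card ?I = Suc (card T)" using x finT by simp
  then show ?thesis using cardT by simp
qed

lemma card_incidences_edges:
  assumes "uniform k H" "finite (hedges H)" "0 < k"
  shows "card (incidences H) = k * card (hedges H)"
proof -
  have "incidences H = prod.swap ` Sigma (hedges H) (\<lambda>e. e)"
    by (auto simp: incidences_def)
  then have "card (incidences H) = card (Sigma (hedges H) (\<lambda>e. e))"
    by (simp add: card_image)
  also have "\<dots> = (\<Sum>e\<in>hedges H. card e)"
    using assms by (intro card_SigmaI) (auto simp: uniform_def intro: card_ge_0_finite)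
  finally show ?thesis using assms(1) by (simp add: uniform_def mult.commute)
qed

lemma card_incidences_verts:
  assumes "hypergraph H" "finite (hedges H)"
  shows "card (incidences H) = (\<Sum>v\<in>verts H. vdegree H v)"
proof -
  have "incidences H = Sigma (verts H) (\<lambda>v. {e \<in> hedges H. v \<in> e})"
    using assms(1) by (auto simp: incidences_def hypergraph_def)
  then show ?thesis
    using assms by (simp add: hypergraph_def vdegree_def)
qed

section \<open>Sums of squared degrees\<close>

text \<open>Write \<open>d = 1 + b + y\<close>, where \<open>b\<close> indicates \<open>W\<close>;
  then \<open>y\<close> sums to \<open>s\<close>. The bound is the value for one degree
  \<open>s + 2\<close> in \<open>W\<close>, degree 2 on the rest of \<open>W\<close> and 1
  elsewhere. It results from estimating the sum of \<open>b * y\<close> by \<open>s\<close> and the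
  sum of the squares of \<open>y\<close> by the square of \<open>s\<close>.\<close>

lemma degree_square_sum:
  fixes d :: "'a \<Rightarrow> nat"
  assumes fin: "finite V" and W: "W \<subseteq> V"
    and d1: "\<And>v. v \<in> V \<Longrightarrow> 1 \<le> d v" and d2: "\<And>v. v \<in> W \<Longrightarrow> 2 \<le> d v"
    and total: "sum d V = card V + card W + s"
  shows degree_square_sum_le: "(\<Sum>v\<in>V. (d v)\<^sup>2) \<le> card V + 3 * card W + 4 * s + s\<^sup>2"
    and degree_square_sum_eq: "(\<Sum>v\<in>V. (d v)\<^sup>2) = card V + 3 * card W + 4 * s + s\<^sup>2 \<Longrightarrow> W \<noteq> {} \<Longrightarrow>
      \<exists>u\<in>W. \<forall>v\<in>V. d v = 1 + of_bool (v \<in> W) + of_bool (v = u) * s"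
    and degree_square_sum_ge: "u \<in> W \<Longrightarrow> s + 2 \<le> d u \<Longrightarrow>
      card V + 3 * card W + 4 * s + s\<^sup>2 \<le> (\<Sum>v\<in>V. (d v)\<^sup>2)"
proof -
  define b :: "'a \<Rightarrow> nat" where "b v = of_bool (v \<in> W)" for v
  define y where "y v = d v - 1 - b v" for v
  have d: "d v = 1 + b v + y v" if "v \<in> V" for v
    using d1[OF that] d2[of v] by (cases "v \<in> W") (auto simp: y_def b_def)
  have sb: "sum b V = card W"
    using W fin by (simp add: b_def of_bool_def sum.If_cases Int_absorb1)
  have "sum d V = (\<Sum>v\<in>V. 1 + b v + y v)" by (rule sum.cong) (simp_all add: d)
  also have "\<dots> = card V + sum b V + sum y V" by (simp only: sum.distrib card_eq_sum)
  finally have sy: "sum y V = s" using total sb by simp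
  have "(\<Sum>v\<in>V. (d v)\<^sup>2) = (\<Sum>v\<in>V. 1 + 3 * b v + 2 * y v + 2 * (b v * y v) + (y v)\<^sup>2)"
  proof (rule sum.cong[OF refl])
    fix v assume "v \<in> V"
    then have "(d v)\<^sup>2 = (1 + b v + y v)\<^sup>2" using d by simp
    also have "\<dots> = 1 + 3 * b v + 2 * y v + 2 * (b v * y v) + (y v)\<^sup>2"
      \<comment> \<open>The coefficient 3 arises because \<open>b v\<close> equals its
        square.\<close>
      by (cases "v \<in> W") (simp_all add: b_def power2_eq_square algebra_simps)
    finally show "(d v)\<^sup>2 = 1 + 3 * b v + 2 * y v + 2 * (b v * y v) + (y v)\<^sup>2" .
  qed
  also have "\<dots> = card V + 3 * sum b V + 2 * sum y V + 2 * (\<Sum>v\<in>V. b v * y v) + (\<Sum>v\<in>V. (y v)\<^sup>2)"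
    by (simp only: sum.distrib card_eq_sum sum_distrib_left)
  finally have expand: "(\<Sum>v\<in>V. (d v)\<^sup>2) = card V + 3 * card W + 2 * s + 2 * (\<Sum>v\<in>V. b v * y v) + (\<Sum>v\<in>V. (y v)\<^sup>2)"
    by (simp only: sb sy)
  have y_le: "y v \<le> s" if "v \<in> V" for v
    using member_le_sum[of v V y] that fin sy by simp
  have by_le: "(\<Sum>v\<in>V. b v * y v) \<le> s"
    unfolding sy[symmetric] by (rule sum_mono) (simp add: b_def)
  have y2_le: "(\<Sum>v\<in>V. (y v)\<^sup>2) \<le> s\<^sup>2"
  proof -
    have "(\<Sum>v\<in>V. (y v)\<^sup>2) \<le> (\<Sum>v\<in>V. s * y v)"
      by (rule sum_mono) (simp add: power2_eq_square y_le)
    also have "\<dots> = s\<^sup>2" by (simp add: sy power2_eq_square flip: sum_distrib_left)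
    finally show ?thesis .
  qed
  show "(\<Sum>v\<in>V. (d v)\<^sup>2) \<le> card V + 3 * card W + 4 * s + s\<^sup>2"
    unfolding expand using by_le y2_le by linarith
  show "card V + 3 * card W + 4 * s + s\<^sup>2 \<le> (\<Sum>v\<in>V. (d v)\<^sup>2)" if u: "u \<in> W" "s + 2 \<le> d u"
  proof -
    have uV: "u \<in> V" using u W by blast
    have yu: "s \<le> y u" "b u = 1" using u by (auto simp: y_def b_def)
    have "b u * y u \<le> (\<Sum>v\<in>V. b v * y v)" using uV fin by (intro member_le_sum) auto
    then have "s \<le> (\<Sum>v\<in>V. b v * y v)" using yu by simp
    moreover have "(y u)\<^sup>2 \<le> (\<Sum>v\<in>V. (y v)\<^sup>2)" using uV fin by (intro member_le_sum) auto
    then have "s\<^sup>2 \<le> (\<Sum>v\<in>V. (y v)\<^sup>2)" using yu power_mono[of s "y u" 2] by linarith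
    ultimately show ?thesis unfolding expand by linarith
  qed
  show "\<exists>u\<in>W. \<forall>v\<in>V. d v = 1 + of_bool (v \<in> W) + of_bool (v = u) * s"
    if eq: "(\<Sum>v\<in>V. (d v)\<^sup>2) = card V + 3 * card W + 4 * s + s\<^sup>2" and "W \<noteq> {}"
  proof -
    have "(\<Sum>v\<in>V. b v * y v) = s" "(\<Sum>v\<in>V. (y v)\<^sup>2) = s\<^sup>2"
      using eq expand by_le y2_le by linarith+
    then have "(\<Sum>v\<in>V. b v * y v) = sum y V" "(\<Sum>v\<in>V. (y v)\<^sup>2) = (\<Sum>v\<in>V. s * y v)"
      by (simp_all add: sy power2_eq_square flip: sum_distrib_left)
    \<comment> \<open>Equal sums of termwise comparable functions agree termwise: \<open>y\<close>
      vanishes outside \<open>W\<close> and takes no values except 0 and \<open>s\<close>.\<close>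
    then have y0: "b v * y v = y v" and ys: "(y v)\<^sup>2 = s * y v" if "v \<in> V" for v
      using sum_mono_inv[of "\<lambda>v. b v * y v" V y v] sum_mono_inv[of "\<lambda>v. (y v)\<^sup>2" V "\<lambda>v. s * y v" v] fin that y_le
      by (auto simp: b_def power2_eq_square)
    obtain u where u: "u \<in> W" "\<forall>v\<in>V. y v = of_bool (v = u) * s"
    \<comment> \<open>Without excess no vertex is distinguished and any element of \<open>W\<close>
      can be chosen.\<close>
    proof (cases "s = 0")
      case True
      obtain u where "u \<in> W" using \<open>W \<noteq> {}\<close> by blast
      moreover have "\<forall>v\<in>V. y v = of_bool (v = u) * s" using y_le True by auto
      ultimately show thesis by (rule that)
    next
      case False
      then have "\<not> (\<forall>v\<in>V. y v = 0)" using sy by (metis sum.neutral)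
      then obtain u where u: "u \<in> V" "y u \<noteq> 0" by blast
      then have uW: "u \<in> W" using y0[of u] by (cases "u \<in> W") (auto simp: b_def)
      have yu: "y u = s" using ys[of u] u by (simp add: power2_eq_square)
      have "sum y (V - {u}) = 0" using sum.remove[OF fin u(1), of y] sy yu by simp
      then have "\<forall>v\<in>V. y v = of_bool (v = u) * s" using fin yu by auto
      with uW show thesis by (rule that)
    qed
    then have "\<forall>v\<in>V. d v = 1 + of_bool (v \<in> W) + of_bool (v = u) * s"
      using d by (simp add: b_def)
    with u(1) show ?thesis by blast
  qed
qed

section \<open>Degrees in the unicyclic class\<close>

lemma two_edges_vdegree:
  assumes "finite (hedges H)" "e \<in> hedges H" "e' \<in> hedges H" "e \<noteq> e'" "v \<in> e" "v \<in> e'"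
  shows "2 \<le> vdegree H v"
proof -
  have "card {e, e'} \<le> vdegree H v"
    unfolding vdegree_def by (rule card_mono) (use assms in auto)
  then show ?thesis using assms by simp
qed

lemma cycle_vertices_vdegree:
  assumes "finite (hedges H)" "is_cycle H vs es" "v \<in> set vs"
  shows "2 \<le> vdegree H v"
proof -
  have c: "cycle_in (incidences H) vs es" using assms(2) by (simp add: is_cycle_iff_cycle_in)
  obtain e e' where "e \<noteq> e'" "(v, e) \<in> cycle_incidences vs es" "(v, e') \<in> cycle_incidences vs es"
    by (rule cycle_incidences_vertex[OF c assms(3)])
  moreover have "cycle_incidences vs es \<subseteq> incidences H" using c by (simp add: cycle_in_def)
  ultimately show ?thesis
    by (intro two_edges_vdegree[OF assms(1), of e e']) (auto simp: incidences_def)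
qed

lemma connected_vdegree_pos:
  assumes "hypergraph H" "connected_hypergraph H" "finite (hedges H)" "hedges H \<noteq> {}" "v \<in> verts H"
  shows "1 \<le> vdegree H v"
proof -
  obtain e where e: "e \<in> hedges H" using assms(4) by blast
  then have "e \<noteq> {}" "e \<subseteq> verts H" using assms(1) by (auto simp: hypergraph_def)
  then obtain u where u: "u \<in> e" "u \<in> verts H" by blast
  have "(v, u) \<in> {(x, y). \<exists>e \<in> hedges H. x \<in> e \<and> y \<in> e}\<^sup>*"
    using assms(2,5) u(2) by (auto simp: connected_hypergraph_def)
  then have "\<exists>e \<in> hedges H. v \<in> e"
    \<comment> \<open>Either \<open>v = u\<close> lies in \<open>e\<close>, or the first step of the
      chain uses a hyperedge containing \<open>v\<close>.\<close>
    by (cases rule: converse_rtranclE) (use e u in auto)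
  then have "{e \<in> hedges H. v \<in> e} \<noteq> {}" by blast
  then show ?thesis using assms(3) by (simp add: vdegree_def Suc_le_eq card_gt_0_iff)
qed

lemma unicyclic_class_facts:
  assumes "H \<in> unicyclic_class k m g" "2 \<le> k" "0 < m"
  shows unicyclic_class_finite: "finite (hedges H)"
    and unicyclic_class_verts: "verts H = {..<m * (k - 1)}"
    and unicyclic_class_degree_sum: "(\<Sum>v<m * (k - 1). vdegree H v) = k * m"
    and unicyclic_class_degree_pos: "v < m * (k - 1) \<Longrightarrow> 1 \<le> vdegree H v"
    and unicyclic_class_cycle: "\<exists>vs es. is_cycle H vs es \<and> length vs = g"
proof -
  have H: "hypergraph H" "uniform k H" "unicyclic H" "card (hedges H) = m" "girth H = g"
    using assms(1) by (auto simp: unicyclic_class_def)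
  have conn: "connected_hypergraph H" using H(3) by (simp add: unicyclic_def)
  have "hedges H \<subseteq> Pow (verts H)" using H(1) by (auto simp: hypergraph_def)
  then show fin: "finite (hedges H)"
    using H(1) by (metis finite_Pow_iff finite_subset hypergraph_def)
  obtain n where n: "verts H = {..<n}" using assms(1) by (auto simp: unicyclic_class_def)
  \<comment> \<open>Both sides count the incidences: through the spanning tree and hyperedge by
    hyperedge.\<close>
  have "n + m = k * m"
    using unicyclic_card_incidences[OF H(1,3) fin] card_incidences_edges[OF H(2) fin] assms(2) H(4) n
    by simp
  then have "n = m * (k - 1)" by (simp add: algebra_simps diff_mult_distrib2)
  with n show V: "verts H = {..<m * (k - 1)}" by simp
  show "(\<Sum>v<m * (k - 1). vdegree H v) = k * m"
    using card_incidences_verts[OF H(1) fin] card_incidences_edges[OF H(2) fin] assms(2) H(4) V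
    by simp
  have "hedges H \<noteq> {}" using H(4) assms(3) by auto
  then show "1 \<le> vdegree H v" if "v < m * (k - 1)"
    using connected_vdegree_pos[OF H(1) conn fin, of v] that V by simp
  have "\<exists>q vs es. is_cycle H vs es \<and> length es = q" using H(3) by (auto simp: unicyclic_def)
  then have "\<exists>vs es. is_cycle H vs es \<and> length es = girth H"
    unfolding girth_def by (rule LeastI_ex)
  then obtain vs es where "is_cycle H vs es" "length es = g" using H(5) by blast
  then show "\<exists>vs es. is_cycle H vs es \<and> length vs = g"
    by (intro exI[of _ vs] exI[of _ es]) (simp add: is_cycle_def)
qed

lemma unicyclic_class_degree_squares:
  assumes "H \<in> unicyclic_class k m g" "2 \<le> k" "0 < m" "g \<le> m" "is_cycle H vs es" "length vs = g"
  defines "bound \<equiv> m * (k - 1) + 3 * g + 4 * (m - g) + (m - g)\<^sup>2"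
  shows unicyclic_class_degree_squares_le: "(\<Sum>v<m * (k - 1). (vdegree H v)\<^sup>2) \<le> bound"
    and unicyclic_class_degree_squares_eq: "(\<Sum>v<m * (k - 1). (vdegree H v)\<^sup>2) = bound \<Longrightarrow>
      \<exists>u\<in>set vs. \<forall>v\<in>verts H. vdegree H v = 1 + of_bool (v \<in> set vs) + of_bool (v = u) * (m - g)"
    and unicyclic_class_degree_squares_ge: "u \<in> set vs \<Longrightarrow> m - g + 2 \<le> vdegree H u \<Longrightarrow>
      bound \<le> (\<Sum>v<m * (k - 1). (vdegree H v)\<^sup>2)"
proof -
  note facts = unicyclic_class_facts[OF assms(1-3)]
  have card: "card (set vs) = g" and ne: "set vs \<noteq> {}"
    using assms(5,6) by (auto simp: is_cycle_def distinct_card)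
  have sub: "set vs \<subseteq> {..<m * (k - 1)}"
  proof
    fix v assume "v \<in> set vs"
    then obtain i where "i < length vs" "v = vs ! i" by (metis in_set_conv_nth)
    then have "v \<in> es ! i" "es ! i \<in> hedges H" using assms(5) by (auto simp: is_cycle_def)
    moreover have "hypergraph H" using assms(1) by (simp add: unicyclic_class_def)
    ultimately show "v \<in> {..<m * (k - 1)}" using facts(2) by (auto simp: hypergraph_def)
  qed
  have "k * m = m * (k - 1) + m" using assms(2) by (cases k) auto
  then have total: "(\<Sum>v<m * (k - 1). vdegree H v) = card {..<m * (k - 1)} + card (set vs) + (m - g)"
    using facts(3) assms(4) card by simp
  have pos: "1 \<le> vdegree H v" if "v \<in> {..<m * (k - 1)}" for v
    using facts(4) that by simp
  note deg2 = cycle_vertices_vdegree[OF facts(1) assms(5)]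
  show "(\<Sum>v<m * (k - 1). (vdegree H v)\<^sup>2) \<le> bound"
    using degree_square_sum_le[OF finite_lessThan sub pos deg2 total] by (simp add: bound_def card)
  show "\<exists>u\<in>set vs. \<forall>v\<in>verts H. vdegree H v = 1 + of_bool (v \<in> set vs) + of_bool (v = u) * (m - g)"
    if "(\<Sum>v<m * (k - 1). (vdegree H v)\<^sup>2) = bound"
    using degree_square_sum_eq[OF finite_lessThan sub pos deg2 total _ ne] that facts(2)
    by (simp add: bound_def card)
  show "bound \<le> (\<Sum>v<m * (k - 1). (vdegree H v)\<^sup>2)" if "u \<in> set vs" "m - g + 2 \<le> vdegree H u"
    using degree_square_sum_ge[OF finite_lessThan sub pos deg2 total that] by (simp add: bound_def card)
qed

section \<open>Hypercycles with pendant hyperedges\<close>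

text \<open>With \<open>q = k - 1\<close>, hyperedge \<open>i\<close> consists of the
  \<open>i\<close>-th block of \<open>q\<close> consecutive numbers and one outer vertex
  \<open>star_next g i * q\<close>: the next core vertex on the cycle, or the centre 0 for a pendant
  hyperedge. Thus both kinds have one form, and the blocks partition the vertices.\<close>

definition star_next :: "nat \<Rightarrow> nat \<Rightarrow> nat" where
  "star_next g i = (if i < g then Suc i mod g else 0)"

definition star_edge :: "nat \<Rightarrow> nat \<Rightarrow> nat \<Rightarrow> nat set" where
  "star_edge q g i = insert (star_next g i * q) {i * q..<Suc i * q}"

lemma hypercycle_star_eq:
  "hypercycle_star k g s =
     \<lparr>verts = {..<(g + s) * (k - 1)}, hedges = star_edge (k - 1) g ` {..<g + s}\<rparr>"
proof (induction s)
  case 0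
  then show ?case
    by (auto simp: hypercycle_star_def hypercycle_def star_edge_def star_next_def intro!: image_cong)
next
  case (Suc s)
  have "hypercycle_star k g (Suc s) = add_pendant k 0 (hypercycle_star k g s)"
    by (simp add: hypercycle_star_def)
  also have "\<dots> = \<lparr>verts = {..<(g + s) * (k - 1)} \<union> {(g + s) * (k - 1)..<(g + s) * (k - 1) + (k - 1)},
    hedges = insert (insert 0 {(g + s) * (k - 1)..<(g + s) * (k - 1) + (k - 1)}) (star_edge (k - 1) g ` {..<g + s})\<rparr>"
    by (simp add: Suc add_pendant_def Let_def)
  also have "{..<(g + s) * (k - 1)} \<union> {(g + s) * (k - 1)..<(g + s) * (k - 1) + (k - 1)} =
    {..<(g + Suc s) * (k - 1)}"
    by (simp add: ivl_disj_un_one algebra_simps)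
  also have "insert 0 {(g + s) * (k - 1)..<(g + s) * (k - 1) + (k - 1)} = star_edge (k - 1) g (g + s)"
    by (simp add: star_edge_def star_next_def algebra_simps)
  finally show ?case by (simp add: lessThan_Suc)
qed

lemma mem_block_iff: "0 < q \<Longrightarrow> x \<in> {i * q..<Suc i * q} \<longleftrightarrow> x div q = i" for q :: nat
  by (auto simp: div_nat_eqI mult.commute dividend_less_times_div)

lemma mem_star_edge_iff: "0 < q \<Longrightarrow> x \<in> star_edge q g i \<longleftrightarrow> x = star_next g i * q \<or> x div q = i"
  unfolding star_edge_def insert_iff mem_block_iff ..

lemma star_next_less: "0 < g \<Longrightarrow> star_next g i < g"
  by (simp add: star_next_def)

lemma star_next_neq: "2 \<le> g \<Longrightarrow> star_next g i \<noteq> i"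
  by (auto simp: star_next_def mod_Suc)

lemma star_next_no_swap: "3 \<le> g \<Longrightarrow> star_next g (star_next g i) \<noteq> i"
  by (auto simp: star_next_def mod_Suc split: if_splits)

lemma star_next_inj: "star_next g i = star_next g j \<Longrightarrow> i < g \<Longrightarrow> j < g \<Longrightarrow> i = j"
  by (auto simp: star_next_def mod_Suc split: if_splits)

lemma card_star_edge: "0 < q \<Longrightarrow> 2 \<le> g \<Longrightarrow> card (star_edge q g i) = Suc q"
proof -
  assume *: "0 < q" "2 \<le> g"
  then have "star_next g i * q \<notin> {i * q..<Suc i * q}"
    unfolding mem_block_iff[OF *(1)] using star_next_neq by simp
  then show ?thesis by (simp add: star_edge_def)
qed

text \<open>A common vertex is the outer vertex of one of the two hyperedges. Two different common
  vertices would require \<open>star_next g\<close> to swap \<open>i\<close> and \<open>j\<close>,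
  which is impossible for \<open>g\<close> at least 3.\<close>

lemma star_edge_Int:
  assumes "0 < q" "3 \<le> g" "i \<noteq> j"
  shows "card (star_edge q g i \<inter> star_edge q g j) \<le> 1"
proof -
  have meet: "x = star_next g i * q \<and> (star_next g j = i \<longrightarrow> star_next g i = star_next g j) \<or> star_next g j = i \<and> x = star_next g j * q"
    if "x \<in> star_edge q g i \<inter> star_edge q g j" for x
  proof -
    have "x = a * q \<Longrightarrow> x div q = a" for a using assms(1) by simp
    then show ?thesis
      using that assms star_next_no_swap[of g j] by (auto simp: mem_star_edge_iff)
  qed
  have "\<exists>c. star_edge q g i \<inter> star_edge q g j \<subseteq> {c}"
  proof (cases "star_next g j = i")
    case True
    then have "x = star_next g j * q" if "x \<in> star_edge q g i \<inter> star_edge q g j" for x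
      using meet[OF that] by metis
    then show ?thesis by blast
  next
    case False
    then have "x = star_next g i * q" if "x \<in> star_edge q g i \<inter> star_edge q g j" for x
      using meet[OF that] by metis
    then show ?thesis by blast
  qed
  then obtain c where "star_edge q g i \<inter> star_edge q g j \<subseteq> {c}" ..
  then have "card (star_edge q g i \<inter> star_edge q g j) \<le> card {c}" by (intro card_mono) auto
  then show ?thesis by simp
qed

lemma star_edge_inj:
  assumes "0 < q" "3 \<le> g" "star_edge q g i = star_edge q g j"
  shows "i = j"
proof (rule ccontr)
  assume "i \<noteq> j"
  from star_edge_Int[OF assms(1,2) this] assms show False by (simp add: card_star_edge)
qed

section \<open>The only cycle of the hypercycle with pendant hyperedges\<close>

definition star_cycle_incidences :: "nat \<Rightarrow> nat \<Rightarrow> (nat \<times> nat set) set" where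
  "star_cycle_incidences q g =
     (\<Union>i<g. {(i * q, star_edge q g i), (star_next g i * q, star_edge q g i)})"

lemma snd_star_cycle_incidences: "snd ` star_cycle_incidences q g = star_edge q g ` {..<g}"
  unfolding star_cycle_incidences_def by force

text \<open>Vertices on a cycle lie in two hyperedges, hence are core vertices. A hyperedge contains
  at most two of these, so a cycle through it is forced to continue to the next one and runs all the
  way round.\<close>

lemma star_cycle:
  fixes H :: "nat hypergraph"
  assumes "0 < q" "3 \<le> g" and H: "hedges H = star_edge q g ` I" and c: "cycle_in (incidences H) vs es"
  shows "cycle_incidences vs es = star_cycle_incidences q g"
proof -
  let ?D = "cycle_incidences vs es" and ?E = "star_edge q g"
  have memE: "x \<in> e" and memD: "\<exists>i. e = ?E i" if "(x, e) \<in> ?D" for x e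
    using that c H by (auto simp: cycle_in_def incidences_def)
  have other: "\<exists>i'. i' \<noteq> i \<and> (x, ?E i') \<in> ?D" if x: "(x, ?E i) \<in> ?D" for x i
  proof -
    have "x \<in> set vs" using cycle_incidences_in_set[OF c x] by blast
    from cycle_incidences_vertex[OF c this] obtain e e' where "e \<noteq> e'" "(x, e) \<in> ?D" "(x, e') \<in> ?D" .
    then obtain e'' where "e'' \<noteq> ?E i" "(x, e'') \<in> ?D" by metis
    with memD[OF this(2)] show ?thesis by auto
  qed
  \<comment> \<open>A vertex inside block \<open>i\<close> that lies in a second hyperedge must be
    the outer vertex of that hyperedge, hence a multiple \<open>l * q\<close> with
    \<open>l < g\<close>.\<close>
  have ends: "(x = i * q \<or> x = star_next g i * q) \<and> (\<exists>l<g. x = l * q)" if x: "(x, ?E i) \<in> ?D" for x i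
  proof (cases "x = star_next g i * q")
    case True
    then show ?thesis using star_next_less[of g i] assms(2) by auto
  next
    case False
    have "x div q = i" using memE[OF x] False assms(1) by (simp add: mem_star_edge_iff)
    obtain i' where i': "i' \<noteq> i" "(x, ?E i') \<in> ?D" using other[OF x] by blast
    have "x = star_next g i' * q"
      using memE[OF i'(2)] i'(1) \<open>x div q = i\<close> assms(1) by (simp add: mem_star_edge_iff)
    moreover have "star_next g i' < g" using star_next_less assms(2) by simp
    ultimately show ?thesis using \<open>x div q = i\<close> assms(1) by auto
  qed
  \<comment> \<open>This excludes pendant hyperedges: their block starts at a multiple
    \<open>i * q\<close> with \<open>i\<close> at least \<open>g\<close>, which is not a core
    vertex.\<close>
  have both: "(i * q, ?E i) \<in> ?D \<and> (star_next g i * q, ?E i) \<in> ?D \<and> i < g" if x: "(x, ?E i) \<in> ?D" for x i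
  proof -
    obtain x' where x': "x' \<noteq> x" "(x', ?E i) \<in> ?D" using cycle_incidences_edge[OF c x] by blast
    have "(i * q, ?E i) \<in> ?D \<and> (star_next g i * q, ?E i) \<in> ?D"
      using ends[OF x] ends[OF x'(2)] x x' by auto
    moreover from this have "i < g" using ends[of "i * q" i] assms(1) by auto
    ultimately show ?thesis by blast
  qed
  \<comment> \<open>The other cycle hyperedge at the outer vertex has it at the start of its block,
    because \<open>star_next\<close> is injective on the cycle.\<close>
  have succ: "(Suc i mod g * q, ?E (Suc i mod g)) \<in> ?D" if x: "(i * q, ?E i) \<in> ?D" for i
  proof -
    have i: "(star_next g i * q, ?E i) \<in> ?D" "i < g" using both[OF x] by auto
    obtain i' where i': "i' \<noteq> i" "(star_next g i * q, ?E i') \<in> ?D" using other[OF i(1)] by blast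
    have "i' < g" using both[OF i'(2)] by blast
    have "star_next g i = i'"
      using ends[OF i'(2)] star_next_inj[of g i i'] \<open>i' < g\<close> i(2) i'(1) assms(1) by auto
    then show ?thesis using i'(2) i(2) by (auto simp: star_next_def)
  qed
  obtain i0 where i0: "(i0 * q, ?E i0) \<in> ?D"
  proof -
    have "vs \<noteq> []" using c by (auto simp: cycle_in_def)
    then have "(vs ! 0, es ! 0) \<in> ?D" by (auto simp: cycle_incidences_def)
    then show thesis using memD both that by metis
  qed
  have shift: "((i0 + n) mod g * q, ?E ((i0 + n) mod g)) \<in> ?D" for n
  proof (induction n)
    case 0
    then show ?case using i0 both[OF i0] by simp
  next
    case (Suc n)
    from succ[OF this] show ?case by (simp add: mod_Suc_eq)
  qed
  have all: "(i * q, ?E i) \<in> ?D" if "i < g" for i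
  proof -
    \<comment> \<open>The offset \<open>g - i0 + i\<close> avoids a truncated difference
      \<open>i - i0\<close>.\<close>
    have "(i0 + (g - i0 + i)) mod g = i" using both[OF i0] that by simp
    then show ?thesis using shift[of "g - i0 + i"] by simp
  qed
  show ?thesis
  proof
    show "?D \<subseteq> star_cycle_incidences q g"
    proof
      fix p assume p: "p \<in> ?D"
      obtain x e where pe: "p = (x, e)" by (cases p)
      then obtain i where i: "e = ?E i" using memD p by blast
      then have "x = i * q \<or> x = star_next g i * q" "i < g"
        using ends[of x i] both[of x i] p pe by auto
      then show "p \<in> star_cycle_incidences q g" using pe i by (auto simp: star_cycle_incidences_def)
    qed
    show "star_cycle_incidences q g \<subseteq> ?D"
      using all both by (auto simp: star_cycle_incidences_def)
  qed
qed

lemma cycle_incidences_standard: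
  assumes "3 \<le> g"
  shows "cycle_incidences (map (\<lambda>i. i * q) [0..<g]) (map (star_edge q g) [0..<g]) = star_cycle_incidences q g"
proof -
  have "map (\<lambda>i. i * q) [0..<g] ! (Suc i mod g) = star_next g i * q" if "i < g" for i
    using that by (simp add: star_next_def)
  then show ?thesis unfolding cycle_incidences_def star_cycle_incidences_def
    by (intro SUP_cong) auto
qed

lemma star_cycle_incidences_subset:
  assumes "0 < q" "3 \<le> g" "g \<le> m" "hedges H = star_edge q g ` {..<m}"
  shows "star_cycle_incidences q g \<subseteq> incidences H"
  using assms by (auto simp: star_cycle_incidences_def incidences_def mem_star_edge_iff)

lemma standard_cycle:
  assumes "0 < q" "3 \<le> g" "g \<le> m" "hedges H = star_edge q g ` {..<m}"
  shows "cycle_in (incidences H) (map (\<lambda>i. i * q) [0..<g]) (map (star_edge q g) [0..<g])"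
  using star_cycle_incidences_subset[OF assms] assms(1,2)
  by (auto simp: cycle_in_def cycle_incidences_standard distinct_map inj_on_def
    intro: star_edge_inj)

text \<open>All vertices are reached from 0: core vertices along the cycle, and any vertex from the
  outer vertex of the hyperedge that owns its block.\<close>

lemma star_connected:
  assumes "0 < q" "3 \<le> g" "g \<le> m" and H: "verts H = {..<m * q}" "hedges H = star_edge q g ` {..<m}"
  shows "connected_hypergraph H"
proof -
  let ?R = "{(x, y). \<exists>e \<in> hedges H. x \<in> e \<and> y \<in> e}"
  have step: "(x, y) \<in> ?R" if "x \<in> star_edge q g i" "y \<in> star_edge q g i" "i < m" for x y i
    using that H(2) by auto
  have sym_R: "sym ?R" by (auto simp: sym_def)
  have sym: "(y, x) \<in> ?R\<^sup>*" if "(x, y) \<in> ?R\<^sup>*" for x y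
    using symD[OF sym_rtrancl[OF sym_R] that] .
  have core: "(0, i * q) \<in> ?R\<^sup>*" if "i < g" for i
    using that
  proof (induction i)
    case (Suc i)
    have "(i * q, Suc i * q) \<in> ?R"
      by (rule step[of _ i]) (use Suc.prems assms in \<open>auto simp: mem_star_edge_iff star_next_def\<close>)
    moreover have "(0, i * q) \<in> ?R\<^sup>*" using Suc by simp
    ultimately show ?case by (rule rtrancl_into_rtrancl[rotated])
  qed simp
  have root: "(0, v) \<in> ?R\<^sup>*" if v: "v < m * q" for v
  proof -
    define i where "i = v div q"
    have "i < m" using v by (simp add: i_def less_mult_imp_div_less)
    have sn: "star_next g i < g" using assms(2) by (simp add: star_next_less)
    have "(star_next g i * q, v) \<in> ?R"
      by (rule step[OF _ _ \<open>i < m\<close>]) (use assms(1) in \<open>auto simp: mem_star_edge_iff i_def\<close>)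
    with core[OF sn] show ?thesis by (rule rtrancl_into_rtrancl)
  qed
  show ?thesis
    unfolding connected_hypergraph_def
  proof (intro conjI ballI)
    have "0 \<in> verts H" using H(1) assms by simp
    then show "verts H \<noteq> {}" by blast
    fix u v assume "u \<in> verts H" "v \<in> verts H"
    then have "u < m * q" "v < m * q" using H(1) by auto
    then show "(u, v) \<in> ?R\<^sup>*" using sym[OF root] root by (blast intro: rtrancl_trans)
  qed
qed

section \<open>The extremal hypergraph: membership and central degree\<close>

lemma hypercycle_star_in_class:
  assumes "2 \<le> k" "3 \<le> g" "g \<le> m"
  shows "hypercycle_star k g (m - g) \<in> unicyclic_class k m g"
proof -
  let ?X = "hypercycle_star k g (m - g)"
  define q where "q = k - 1"
  have q: "0 < q" "k = Suc q" using assms(1) by (auto simp: q_def)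
  have V: "verts ?X = {..<m * q}" and E: "hedges ?X = star_edge q g ` {..<m}"
    using assms(3) by (simp_all add: hypercycle_star_eq q_def)
  have inj: "inj_on (star_edge q g) A" for A
    using star_edge_inj[OF q(1) assms(2)] by (auto intro: inj_onI)
  note std = standard_cycle[OF q(1) assms(2,3) E]
  have all: "cycle_incidences vs es = star_cycle_incidences q g" if "is_cycle ?X vs es" for vs es
    using star_cycle[OF q(1) assms(2) E] that by (simp add: is_cycle_iff_cycle_in)
  \<comment> \<open>All cycles traverse the same incidences, hence the same \<open>g\<close>
    hyperedges, and these are listed without repetition.\<close>
  have len: "length es = g" if "is_cycle ?X vs es" for vs es
  proof -
    have "set es = star_edge q g ` {..<g}"
      using snd_cycle_incidences[of "incidences ?X" vs es] all[OF that] that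
      by (simp add: is_cycle_iff_cycle_in snd_star_cycle_incidences)
    moreover have "distinct es" using that by (simp add: is_cycle_def)
    ultimately show ?thesis
      by (metis card_image card_lessThan distinct_card inj)
  qed
  have "hypergraph ?X"
    unfolding hypergraph_def V E
  proof (intro conjI ballI)
    fix e assume "e \<in> star_edge q g ` {..<m}"
    then obtain i where i: "e = star_edge q g i" "i < m" by blast
    show "e \<noteq> {}" using i by (simp add: star_edge_def)
    show "e \<subseteq> {..<m * q}"
    proof
      fix x assume x: "x \<in> e"
      have "x div q < m"
        using x i q(1) assms star_next_less[of g i] by (auto simp: mem_star_edge_iff)
      then show "x \<in> {..<m * q}" using q(1) by (simp add: div_less_iff_less_mult)
    qed
  qed simp
  moreover have "uniform k ?X"
    unfolding uniform_def E using q(1) assms(2) by (auto simp: card_star_edge q(2))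
  moreover have "linear_hypergraph ?X"
    unfolding linear_hypergraph_def E
  proof (intro ballI impI)
    fix e f assume "e \<in> star_edge q g ` {..<m}" "f \<in> star_edge q g ` {..<m}" "e \<noteq> f"
    then obtain i j where ij: "e = star_edge q g i" "f = star_edge q g j" "i \<noteq> j" by blast
    show "card (e \<inter> f) \<le> 1" unfolding ij(1,2) by (rule star_edge_Int[OF q(1) assms(2) ij(3)])
  qed
  moreover have "unicyclic ?X"
    unfolding unicyclic_def
  proof (intro conjI ex1I)
    show "connected_hypergraph ?X" by (rule star_connected[OF q(1) assms(2,3) V E])
    show "\<exists>vs es. is_cycle ?X vs es \<and> star_cycle_incidences q g = cycle_incidences vs es"
      using std cycle_incidences_standard[OF assms(2)] is_cycle_iff_cycle_in by metis
    show "C = star_cycle_incidences q g" if "\<exists>vs es. is_cycle ?X vs es \<and> C = cycle_incidences vs es" for C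
      using that all by blast
  qed
  moreover have "card (hedges ?X) = m" unfolding E by (simp add: card_image[OF inj])
  moreover have "girth ?X = g"
    unfolding girth_def
  proof (rule Least_equality)
    show "\<exists>vs es. is_cycle ?X vs es \<and> length es = g"
      using std len is_cycle_iff_cycle_in by metis
    show "g \<le> l" if "\<exists>vs es. is_cycle ?X vs es \<and> length es = l" for l
      using that len by auto
  qed
  ultimately show ?thesis using V by (auto simp: unicyclic_class_def)
qed

text \<open>Vertex 0 starts block 0 and is the outer vertex of hyperedge \<open>g - 1\<close> and of
  all pendant ones. A lower bound suffices, as \<open>degree_square_sum_ge\<close> asks for no
  more.\<close>

lemma hypercycle_star_center_degree:
  assumes "2 \<le> k" "3 \<le> g" "g \<le> m"
  shows "m - g + 2 \<le> vdegree (hypercycle_star k g (m - g)) 0"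
proof -
  let ?X = "hypercycle_star k g (m - g)"
  define q where "q = k - 1"
  have q: "0 < q" using assms(1) by (auto simp: q_def)
  have E: "hedges ?X = star_edge q g ` {..<m}"
    using assms(3) by (simp add: hypercycle_star_eq q_def)
  let ?I = "{0, g - 1} \<union> {g..<m}"
  have "m - g + 2 = card ?I" using assms(2) by (subst card_Un_disjoint) auto
  also have "\<dots> = card (star_edge q g ` ?I)"
    using star_edge_inj[OF q assms(2)] by (intro card_image[symmetric]) (auto intro: inj_onI)
  also have "\<dots> \<le> vdegree ?X 0"
    unfolding vdegree_def E
    by (rule card_mono) (use assms q in \<open>auto simp: mem_star_edge_iff star_next_def\<close>)
  finally show ?thesis .
qed

section \<open>The extremal hypergraph\<close>

text \<open>This allows the vertex of large degree to be placed at position 0 of the cycle, matching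
  the centre 0 of the model.\<close>

lemma is_cycle_rotate:
  assumes "is_cycle H vs es"
  shows "is_cycle H (rotate r vs) (rotate r es)"
proof -
  let ?n = "length vs"
  have n: "0 < ?n" "length es = ?n" using assms by (auto simp: is_cycle_def)
  have "rotate r vs ! i \<in> rotate r es ! i \<and> rotate r vs ! (Suc i mod ?n) \<in> rotate r es ! i" if "i < ?n" for i
  proof -
    have "(r + Suc i mod ?n) mod ?n = Suc ((r + i) mod ?n) mod ?n" by (simp add: mod_simps)
    moreover have "(r + i) mod ?n < ?n" "Suc i mod ?n < ?n" using n(1) by auto
    ultimately show ?thesis
      using assms that n by (simp add: nth_rotate is_cycle_def)
  qed
  then show ?thesis using assms by (simp add: is_cycle_def)
qed

text \<open>A chain from inside \<open>e\<close> to a vertex outside has to leave \<open>e\<close>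
  through another hyperedge. This is how hyperedges off the cycle are shown to contain a vertex of
  degree at least 2.\<close>

lemma connected_edge_meets_other:
  assumes "connected_hypergraph H" "hypergraph H" "e \<in> hedges H" "f \<in> hedges H" "\<not> f \<subseteq> e"
  obtains a e' where "a \<in> e" "a \<in> e'" "e' \<in> hedges H" "e' \<noteq> e"
proof -
  have "e \<noteq> {}" "e \<subseteq> verts H" "f \<subseteq> verts H" using assms(2-4) by (auto simp: hypergraph_def)
  then obtain x y where xy: "x \<in> e" "x \<in> verts H" "y \<notin> e" "y \<in> verts H" using assms(5) by blast
  then have "(x, y) \<in> {(x, y). \<exists>e \<in> hedges H. x \<in> e \<and> y \<in> e}\<^sup>*"
    using assms(1) by (simp add: connected_hypergraph_def)
  then have "y \<in> e \<or> (\<exists>a e'. a \<in> e \<and> a \<in> e' \<and> e' \<in> hedges H \<and> e' \<noteq> e)"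
  proof (induction rule: rtrancl_induct)
    case (step y z)
    then show ?case by blast
  qed (use xy(1) in blast)
  then show thesis using xy(3) that by blast
qed

text \<open>Blocks may be matched arbitrarily, except that a core vertex must go to the first number
  of its block.\<close>

lemma ex_bij_betw_point:
  assumes "finite A" "finite B" "card A = card B" "a \<in> A" "b \<in> B"
  shows "\<exists>h. bij_betw h A B \<and> h a = b"
proof -
  obtain h where "bij_betw h (A - {a}) (B - {b})"
    using finite_same_card_bij[of "A - {a}" "B - {b}"] assms by auto
  then have "bij_betw (h(a := b)) (A - {a}) (B - {b})"
    using bij_betw_cong[of "A - {a}" h "h(a := b)"] by auto
  then have "bij_betw (h(a := b)) (insert a (A - {a})) (insert b (B - {b}))"
    using notIn_Un_bij_betw[of a "A - {a}" "h(a := b)" "B - {b}"] by simp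
  then show ?thesis using assms(4,5) by (intro exI[of _ "h(a := b)"]) (simp add: insert_absorb)
qed

text \<open>The degrees determine all hyperedges at each cycle vertex. Listing the cycle hyperedges
  before the others and removing from each its outer vertex yields disjoint blocks of
  \<open>k - 1\<close> vertices that fill the vertex set; block-wise bijections are then glued
  together.\<close>

lemma star_degrees_isomorphic:
  assumes "H \<in> unicyclic_class k m g" "2 \<le> k" "3 \<le> g" "g \<le> m"
    and cyc: "is_cycle H vs es" "length vs = g"
    and deg: "\<And>v. v \<in> verts H \<Longrightarrow>
      vdegree H v = 1 + of_bool (v \<in> set vs) + of_bool (v = vs ! 0) * (m - g)"
  shows "isomorphic H (hypercycle_star k g (m - g))"
proof -
  define q where "q = k - 1"
  have q: "0 < q" "k = Suc q" using assms(2) by (auto simp: q_def)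
  have "0 < m" using assms(3,4) by simp
  note facts = unicyclic_class_facts[OF assms(1,2) \<open>0 < m\<close>, folded q_def]
  have H: "hypergraph H" "\<And>e. e \<in> hedges H \<Longrightarrow> card e = k" "linear_hypergraph H"
    "connected_hypergraph H" "card (hedges H) = m"
    using assms(1) by (auto simp: unicyclic_class_def uniform_def unicyclic_def)
  have es: "length es = g" "distinct es" "distinct vs" "set es \<subseteq> hedges H"
    and on: "\<And>i. i < g \<Longrightarrow> vs ! i \<in> es ! i \<and> vs ! (Suc i mod g) \<in> es ! i"
    using cyc by (auto simp: is_cycle_def)
  have vs_verts: "vs ! i \<in> verts H" if "i < g" for i
  proof -
    have "es ! i \<in> hedges H" using that es(1,4) nth_mem[of i es] by auto
    then have "es ! i \<subseteq> verts H" using H(1) by (auto simp: hypergraph_def)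
    then show ?thesis using on[OF that] by blast
  qed
  let ?u = "vs ! 0"
  have branch: "v \<in> set vs" if "v \<in> verts H" "2 \<le> vdegree H v" for v
  proof (rule ccontr)
    assume "v \<notin> set vs"
    moreover have "?u \<in> set vs" using cyc(2) assms(3) by (intro nth_mem) simp
    ultimately have "vdegree H v = 1" using deg[OF that(1)] by (cases "v = ?u") auto
    with that(2) show False by simp
  qed
  define At where "At v = {e \<in> hedges H. v \<in> e}" for v
  have card_At: "card (At v) = vdegree H v" for v by (simp add: At_def vdegree_def)
  have finite_At: "finite (At v)" for v using facts(1) by (simp add: At_def)
  define P where "P = hedges H - set es"
  have cardP: "card P = m - g" using facts(1) es H(5) by (simp add: P_def card_Diff_subset distinct_card)
  define pred where "pred i = (if i = 0 then g - 1 else i - 1)" for i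
  have pred: "pred i < g" "Suc (pred i) mod g = i" "pred i \<noteq> i" if "i < g" for i
    using that assms(3) by (auto simp: pred_def)
  have cycle_At: "{es ! i, es ! pred i} \<subseteq> At (vs ! i)" "card {es ! i, es ! pred i} = 2" if "i < g" for i
    using on[OF that] on[OF pred(1)[OF that]] pred[OF that] that es
    by (auto simp: At_def nth_eq_iff_index_eq card_insert_if)
  have At_other: "At (vs ! i) = {es ! i, es ! pred i}" if "0 < i" "i < g" for i
  proof -
    have "vs ! i \<noteq> ?u" using that es(3) cyc(2) by (simp add: nth_eq_iff_index_eq)
    then have "card (At (vs ! i)) = 2"
      using deg[OF vs_verts[OF that(2)]] that(2) cyc(2) by (simp add: card_At)
    then show ?thesis using card_subset_eq[OF finite_At cycle_At(1)[OF that(2)]] cycle_At(2)[OF that(2)] by simp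
  qed
  \<comment> \<open>By connectedness \<open>e\<close> shares a vertex \<open>a\<close> with another
    hyperedge, so \<open>a\<close> is on the cycle. At a cycle vertex other than \<open>?u\<close>
    the two cycle hyperedges already exhaust the degree.\<close>
  have pendant: "?u \<in> e" if e: "e \<in> P" for e
  proof -
    have "es ! 0 \<in> set es" using es(1) assms(3) by (intro nth_mem) simp
    then have e': "e \<in> hedges H" "e \<noteq> es ! 0" "es ! 0 \<in> hedges H"
      using e es(4) by (auto simp: P_def)
    have "\<not> es ! 0 \<subseteq> e"
    proof
      assume "es ! 0 \<subseteq> e"
      then have "card (es ! 0 \<inter> e) = k" using H(2)[OF e'(3)] by (simp add: Int_absorb2)
      moreover have "card (es ! 0 \<inter> e) \<le> 1" using H(3) e' by (auto simp: linear_hypergraph_def)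
      ultimately show False using assms(2) by simp
    qed
    from connected_edge_meets_other[OF H(4,1) e'(1,3) this]
    obtain a f where a: "a \<in> e" "a \<in> f" "f \<in> hedges H" "f \<noteq> e" .
    have "2 \<le> vdegree H a"
      by (rule two_edges_vdegree[OF facts(1) e'(1) a(3) a(4)[symmetric] a(1,2)])
    moreover have "a \<in> verts H" using a(1) e'(1) H(1) by (auto simp: hypergraph_def)
    ultimately have "a \<in> set vs" by (rule branch[rotated])
    then obtain i where i: "i < g" "a = vs ! i" using cyc(2) by (metis in_set_conv_nth)
    have "i = 0"
    proof (rule ccontr)
      assume "i \<noteq> 0"
      then have "e \<in> {es ! i, es ! pred i}" using At_other[of i] i a(1) e'(1) by (auto simp: At_def)
      then have "e \<in> set es" using i(1) pred(1)[OF i(1)] es(1) by auto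
      then show False using e by (simp add: P_def)
    qed
    then show ?thesis using a(1) i(2) by simp
  qed
  have At_u: "At ?u = {es ! 0, es ! pred 0} \<union> P"
  proof -
    have 0: "0 < g" using assms(3) by simp
    have sub: "{es ! 0, es ! pred 0} \<union> P \<subseteq> At ?u"
      using cycle_At(1)[OF 0] pendant by (auto simp: At_def P_def)
    have "{es ! 0, es ! pred 0} \<inter> P = {}" using pred(1)[OF 0] 0 es(1) by (auto simp: P_def)
    moreover have "finite P" using facts(1) by (simp add: P_def)
    ultimately have "card ({es ! 0, es ! pred 0} \<union> P) = 2 + (m - g)"
      unfolding cycle_At(2)[OF 0, symmetric] cardP[symmetric] by (intro card_Un_disjoint) auto
    moreover have "card (At ?u) = 2 + (m - g)"
      using deg[OF vs_verts[OF 0]] cyc(2) 0 by (simp add: card_At)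
    ultimately show ?thesis using card_subset_eq[OF finite_At sub] by simp
  qed
  obtain ps where ps: "set ps = P" "distinct ps"
    using finite_distinct_list[of P] facts(1) by (auto simp: P_def)
  define fs where "fs = es @ ps"
  have fs: "distinct fs" "set fs = hedges H" "length fs = m"
    using es ps cardP distinct_card[OF ps(2)] assms(4) by (auto simp: fs_def P_def)
  have fs_cycle: "fs ! i = es ! i" if "i < g" for i using that es(1) by (simp add: fs_def nth_append)
  have fs_pendant: "fs ! i \<in> P" if "g \<le> i" "i < m" for i
  proof -
    have "i - g < length ps" using that es(1) fs(3) by (simp add: fs_def)
    then have "ps ! (i - g) \<in> set ps" by (rule nth_mem)
    then show ?thesis using that es(1) ps(1) by (simp add: fs_def nth_append)
  qed
  have fs_edge: "fs ! i \<in> hedges H" if "i < m" for i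
    using nth_mem[of i fs] that fs(2,3) by simp
  have next_in: "vs ! star_next g i \<in> fs ! i" if "i < m" for i
    using that on[of i] pendant[OF fs_pendant, of i]
    by (cases "i < g") (auto simp: star_next_def fs_cycle)
  define B where "B i = fs ! i - {vs ! star_next g i}" for i
  have finite_edge: "finite (fs ! i)" if "i < m" for i
    using H(2)[OF fs_edge[OF that]] assms(2) by (intro card_ge_0_finite) simp
  have cardB: "card (B i) = q" "finite (B i)" if "i < m" for i
    using H(2)[OF fs_edge[OF that]] next_in[OF that] finite_edge[OF that] q by (simp_all add: B_def)
  \<comment> \<open>At \<open>vs ! l\<close> there are only the hyperedges \<open>l\<close> and
    \<open>pred l\<close>, and for \<open>l = 0\<close> the pendant ones. For all but hyperedge
    \<open>l\<close> this vertex is the outer one and has been removed from the block.\<close>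
  have core_B: "i = l" if i: "i < m" and l: "l < g" and v: "vs ! l \<in> B i" for i l
  proof -
    have At: "fs ! i \<in> At (vs ! l)" using v fs_edge[OF i] by (simp add: At_def B_def)
    have nl: "star_next g i \<noteq> l" using v by (auto simp: B_def)
    have "fs ! i = fs ! l \<or> fs ! i = fs ! pred l"
    proof (cases "l = 0")
      case True
      have "i < g" using nl True by (auto simp: star_next_def split: if_splits)
      then have "fs ! i \<notin> P" using fs_cycle es(1) by (simp add: P_def)
      then show ?thesis using At At_u True fs_cycle l pred(1)[OF l] by auto
    next
      case False
      then show ?thesis using At At_other[of l] fs_cycle l pred(1)[OF l] by auto
    qed
    then have "i = l \<or> i = pred l"
      using fs(1,3) i l pred(1)[OF l] assms(4) by (simp add: nth_eq_iff_index_eq)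
    then show ?thesis using nl pred[OF l] by (auto simp: star_next_def)
  qed
  have disj: "B i \<inter> B j = {}" if ij: "i < m" "j < m" "i \<noteq> j" for i j
  proof (rule equals0I)
    fix v assume v: "v \<in> B i \<inter> B j"
    then have vv: "v \<in> fs ! i" "v \<in> fs ! j" by (auto simp: B_def)
    have "fs ! i \<noteq> fs ! j" using ij fs by (simp add: nth_eq_iff_index_eq)
    then have "2 \<le> vdegree H v"
      using two_edges_vdegree[OF facts(1) fs_edge[OF ij(1)] fs_edge[OF ij(2)]] vv by blast
    moreover have "v \<in> verts H" using vv fs_edge[OF ij(1)] H(1) by (auto simp: hypergraph_def)
    ultimately have "v \<in> set vs" by (rule branch[rotated])
    then obtain l where "l < g" "v = vs ! l" using cyc(2) by (metis in_set_conv_nth)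
    then show False using core_B[of i l] core_B[of j l] v ij by auto
  qed
  \<comment> \<open>By counting: \<open>m\<close> disjoint blocks of size \<open>q\<close> inside a
    set of \<open>m * q\<close> vertices.\<close>
  have BV: "(\<Union>i<m. B i) = verts H"
  proof (rule card_subset_eq)
    show "finite (verts H)" by (simp add: facts(2))
    show "(\<Union>i<m. B i) \<subseteq> verts H"
      using fs_edge H(1) by (fastforce simp: B_def hypergraph_def)
    have "card (\<Union>i<m. B i) = (\<Sum>i<m. card (B i))"
      using cardB(2) disj by (intro card_UN_disjoint) auto
    then show "card (\<Union>i<m. B i) = card (verts H)" by (simp add: cardB(1) facts(2))
  qed
  have "\<exists>h. bij_betw h (B i) {i * q..<Suc i * q} \<and> (i < g \<longrightarrow> h (vs ! i) = i * q)" if i: "i < m" for i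
  proof (cases "i < g")
    case True
    have "vs ! i \<noteq> vs ! star_next g i"
      using star_next_neq[of g i] star_next_less[of g i] True es(3) cyc(2) assms(3)
      by (simp add: nth_eq_iff_index_eq)
    then have "vs ! i \<in> B i" using on[OF True] fs_cycle[OF True] by (simp add: B_def)
    then show ?thesis
      using ex_bij_betw_point[OF cardB(2)[OF i], of "{i * q..<Suc i * q}" "vs ! i" "i * q"] cardB(1)[OF i] q(1)
      by auto
  next
    case False
    then show ?thesis
      using finite_same_card_bij[OF cardB(2)[OF i], of "{i * q..<Suc i * q}"] cardB(1)[OF i] by simp
  qed
  then obtain h where h: "\<And>i. i < m \<Longrightarrow> bij_betw (h i) (B i) {i * q..<Suc i * q}"
    and h0: "\<And>i. i < g \<Longrightarrow> h i (vs ! i) = i * q"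
    using assms(4) by (metis order_less_le_trans)
  \<comment> \<open>Each vertex lies in exactly one block, so the description picks its
    index.\<close>
  define f where "f v = h (THE i. i < m \<and> v \<in> B i) v" for v
  have f: "f v = h i v" if "i < m" "v \<in> B i" for i v
  proof -
    have "(THE i. i < m \<and> v \<in> B i) = i"
      using that disj by (intro the_equality) blast+
    then show ?thesis by (simp add: f_def)
  qed
  have f_B: "f ` B i = {i * q..<Suc i * q}" if "i < m" for i
    using h[OF that] f[OF that] by (simp add: bij_betw_def cong: image_cong)
  have f_vs: "f (vs ! i) = i * q" if "i < g" for i
  proof -
    have "vs ! i \<in> verts H" by (rule vs_verts[OF that])
    then obtain j where "j < m" "vs ! i \<in> B j" using BV by blast
    then show ?thesis using core_B[of j i] that f[of j "vs ! i"] h0 by auto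
  qed
  have f_edge: "f ` (fs ! i) = star_edge q g i" if "i < m" for i
  proof -
    have "fs ! i = insert (vs ! star_next g i) (B i)" using next_in[OF that] by (auto simp: B_def)
    then show ?thesis
      using f_B[OF that] f_vs[of "star_next g i"] star_next_less[of g i] assms(3)
      by (simp add: star_edge_def)
  qed
  have f_verts: "f ` verts H = {..<m * q}"
  proof -
    have "f ` verts H = (\<Union>i<m. {i * q..<Suc i * q})"
      unfolding BV[symmetric] image_UN using f_B by simp
    also have "\<dots> = {..<m * q}"
      using q(1) by (auto simp only: UN_iff mem_block_iff lessThan_iff) (auto simp: div_less_iff_less_mult)
    finally show ?thesis .
  qed
  \<comment> \<open>Injectivity comes from counting, since \<open>f\<close> maps onto a set of the
    same size.\<close>
  have "inj_on f (verts H)" by (rule eq_card_imp_inj_on) (unfold f_verts, simp_all add: facts(2))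
  then have "bij_betw f (verts H) {..<m * q}" using f_verts by (simp add: bij_betw_def)
  moreover have "(\<lambda>e. f ` e) ` hedges H = star_edge q g ` {..<m}"
  proof -
    have "hedges H = (\<lambda>i. fs ! i) ` {..<m}" using fs by (auto simp: set_conv_nth)
    then show ?thesis using f_edge by (simp add: image_image)
  qed
  ultimately show ?thesis
    unfolding isomorphic_def hypercycle_star_eq using assms(4) by (auto simp: q_def)
qed

theorem theorem5p1:
  fixes k m g :: nat and \<alpha> :: real
  assumes "2 \<le> k" and "3 \<le> m" and "3 \<le> g" and "g \<le> m" and "0 < \<alpha>" and "\<alpha> < 1"
  shows "is_last \<alpha> k (unicyclic_class k m g) (hypercycle_star k g (m - g))"
  unfolding is_last_def
proof (intro conjI ballI impI)
  let ?X = "hypercycle_star k g (m - g)"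
  let ?bound = "m * (k - 1) + 3 * g + 4 * (m - g) + (m - g)\<^sup>2"
  show X: "?X \<in> unicyclic_class k m g"
    by (rule hypercycle_star_in_class[OF assms(1,3,4)])
  fix H assume H: "H \<in> unicyclic_class k m g" and noniso: "\<not> isomorphic H ?X"
  have m: "0 < m" using assms(2) by simp
  note HF = unicyclic_class_facts[OF H assms(1) m] and XF = unicyclic_class_facts[OF X assms(1) m]
  let ?n = "m * (k - 1)"
  have X_ge: "?bound \<le> (\<Sum>v<?n. (vdegree ?X v)\<^sup>2)"
  proof -
    have "hedges ?X = star_edge (k - 1) g ` {..<m}"
      using assms(4) by (simp add: hypercycle_star_eq)
    then have "is_cycle ?X (map (\<lambda>i. i * (k - 1)) [0..<g]) (map (star_edge (k - 1) g) [0..<g])"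
      using standard_cycle[of "k - 1" g m ?X] assms by (simp add: is_cycle_iff_cycle_in)
    moreover have "0 \<in> set (map (\<lambda>i. i * (k - 1)) [0..<g])"
      using assms(3) by (auto simp: image_iff intro!: bexI[of _ 0])
    ultimately show ?thesis
      using unicyclic_class_degree_squares_ge[OF X assms(1) m assms(4)]
        hypercycle_star_center_degree[OF assms(1,3,4)] by simp
  qed
  have H_less: "(\<Sum>v<?n. (vdegree H v)\<^sup>2) < ?bound"
  proof (rule ccontr)
    assume ge: "\<not> ?thesis"
    obtain vs es where c: "is_cycle H vs es" "length vs = g" using HF(5) by blast
    have "(\<Sum>v<?n. (vdegree H v)\<^sup>2) = ?bound"
      using unicyclic_class_degree_squares_le[OF H assms(1) m assms(4) c] ge by simp
    then obtain u where u: "u \<in> set vs"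
      "\<forall>v\<in>verts H. vdegree H v = 1 + of_bool (v \<in> set vs) + of_bool (v = u) * (m - g)"
      using unicyclic_class_degree_squares_eq[OF H assms(1) m assms(4) c] by blast
    obtain r where r: "r < length vs" "u = vs ! r" using u(1) by (metis in_set_conv_nth)
    \<comment> \<open>\<open>star_degrees_isomorphic\<close> expects the exceptional vertex at
      position 0.\<close>
    then have "rotate r vs ! 0 = u" by (subst nth_rotate) auto
    then have "isomorphic H ?X"
      using u(2) c by (intro star_degrees_isomorphic[OF H assms(1,3,4) is_cycle_rotate[OF c(1), of r]]) auto
    with noniso show False by blast
  qed
  let ?T = "\<lambda>t G. Tr ?n k t (A_alpha \<alpha> k G)"
  have T1: "?T 1 G = real ((k - 1) ^ (?n - 1)) * (\<alpha> * real (k * m))"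
    and T2: "?T 2 G = real ((k - 1) ^ (?n - 1)) * (\<alpha>\<^sup>2 * real (\<Sum>v<?n. (vdegree G v)\<^sup>2) +
      (if k = 2 then 2 * (1 - \<alpha>)\<^sup>2 * real m else 0))"
    if G: "G \<in> unicyclic_class k m g" for G
  proof -
    note GF = unicyclic_class_facts[OF G assms(1) m]
    have unif: "uniform k G" and card: "card (hedges G) = m" and "hypergraph G"
      using G by (auto simp: unicyclic_class_def)
    then have sub: "e \<subseteq> {..<?n}" if "e \<in> hedges G" for e
      using that GF(2) by (auto simp: hypergraph_def)
    show "?T 1 G = real ((k - 1) ^ (?n - 1)) * (\<alpha> * real (k * m))"
      unfolding Tr_1_A_alpha[OF unif assms(1)] GF(3) ..
    show "?T 2 G = real ((k - 1) ^ (?n - 1)) * (\<alpha>\<^sup>2 * real (\<Sum>v<?n. (vdegree G v)\<^sup>2) +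
      (if k = 2 then 2 * (1 - \<alpha>)\<^sup>2 * real m else 0))"
      using Tr_2_A_alpha[OF unif assms(1) sub] card by simp
  qed
  have "?T 0 H = ?T 0 ?X" by (simp add: Tr_def)
  then have below: "\<forall>t<2. ?T t H = ?T t ?X"
    using T1[OF H] T1[OF X] by (simp add: less_2_cases_iff)
  have "?T 2 H < ?T 2 ?X"
  proof -
    have "(\<Sum>v<?n. (vdegree H v)\<^sup>2) < (\<Sum>v<?n. (vdegree ?X v)\<^sup>2)"
      using H_less X_ge by linarith
    then have "\<alpha>\<^sup>2 * real (\<Sum>v<?n. (vdegree H v)\<^sup>2) < \<alpha>\<^sup>2 * real (\<Sum>v<?n. (vdegree ?X v)\<^sup>2)"
      using assms(5) by (intro mult_strict_left_mono) (simp_all only: of_nat_less_iff, simp)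
    moreover have "0 < real ((k - 1) ^ (?n - 1))" using assms(1) by simp
    ultimately show ?thesis
      unfolding T2[OF H] T2[OF X] by (rule mult_strict_left_mono[OF add_strict_right_mono])
  qed
  moreover have "2 \<in> {1..?n * (k - 1) ^ (?n - 1) - 1}"
  proof -
    \<comment> \<open>The trace order 2 is admissible because the number of eigenvalues is at least
      3, which uses \<open>3 \<le> m\<close>.\<close>
    have "3 * 1 * 1 \<le> m * (k - 1) * (k - 1) ^ (?n - 1)"
      using assms(1,2) by (intro mult_le_mono) (auto simp: Suc_le_eq)
    then show ?thesis by simp
  qed
  moreover have "card (verts H) = ?n" "card (verts ?X) = ?n" using HF(2) XF(2) by simp_all
  ultimately show "S_less \<alpha> k H ?X"
    unfolding S_less_def Let_def using below by auto
qed

end
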